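(* Let $x$ be a vector of $n$ variables, $f(x,y,z)$ a vector of polynomial terms of dimension $n$, $y\in Y$, $z\in Z$ first-order real-arithmetic formulas with only free variables $y$ resp. $z$, defining compact sets, with $f$ bounded on $\mathbb R^n\times Y\times Z$, and let $g$ be a polynomial term. If the formula $\exists\varepsilon\,(\varepsilon>0\land\forall x\,\exists z\,(z\in Z\land\forall y\,(y\in Y\to(g\le0\to (g)'^{\,f(x,y,z)}_{x'}\ge\varepsilon))))$ is valid, then $\langle x'=f(x,y,z)\ \&\ y\in Y\ \&\ z\in Z\rangle\, g\ge0$ is valid.
   Context: Syntactic derivation of polynomial terms: $(r)'=0$ for numbers, $(x)'=x'$ for variables, $(a+b)'=(a)'+(b)'$, $(a\cdot b)'=(a)'\cdot b+a\cdot(b)'$; $(g)'^{\,\theta}_{x'}$ is the result of substituting $\theta$ for $x'$ in $(g)'$ and $0$ for all other differential symbols. Semantics: a state $\omega$ maps variables to reals. For $T\ge0$, $\mathcal M_Y$ ($\mathcal M_Z$) are measurable functions $[0,T]\to Y$ ($\to Z$); $\Delta_Z$ is the set of nonanticipative strategies $\beta:\mathcal M_Y\to\mathcal M_Z$ (for all $s$: $y=\hat y$ a.e. on $[0,s]$ implies $\beta(y)=\beta(\hat y)$ a.e. on $[0,s]$). The response $x^{y,z}_\omega(\zeta)$ is the state equal to $\omega$ except $x$ takes the value at time $\zeta$ of the unique Carathéodory solution of $x'(s)=f(x(s),y(s),z(s))$, $x(0)=\omega(x)$. The formula $\langle x'=f(x,y,z)\ \&\ y\in Y\ \&\ z\in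 Z\rangle G$ holds in $\omega$ iff there exist $T\ge0$ and $\beta\in\Delta_Z$ such that for all $y\in\mathcal M_Y$ there is $\zeta\in[0,T]$ with $G$ true in $x^{y,\beta(y)}_\omega(\zeta)$. Valid means true in all states.
   Formalization: The term g is additionally required not to mention the control variables y and z (other parameters are allowed); otherwise the claim fails, e.g. f = 0, Y = Z = {0}, g = 1 − 2y in a state with y = 1. *)

theory Defs
  imports "HOL-Analysis.Analysis"
begin

type_synonym 'v state = "'v \<Rightarrow> real"

datatype 'v trm =
    Const real
  | Var 'v
  | Plus "'v trm" "'v trm"
  | Times "'v trm" "'v trm"

primrec trm_val :: "'v trm \<Rightarrow> 'v state \<Rightarrow> real" where
  "trm_val (Const r) \<omega> = r"
| "trm_val (Var v) \<omega> = \<omega> v"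
| "trm_val (Plus a b) \<omega> = trm_val a \<omega> + trm_val b \<omega>"
| "trm_val (Times a b) \<omega> = trm_val a \<omega> * trm_val b \<omega>"

text \<open>The derivation maps terms over \<open>'v\<close> to terms over the symbols \<open>v\<close> and \<open>v'\<close>, so a
  polynomial term itself contains no differential symbols.\<close>

datatype 'v sym = Base 'v | Prime 'v

primrec derivation :: "'v trm \<Rightarrow> 'v sym trm" where
  "derivation (Const r) = Const 0"
| "derivation (Var v) = Var (Prime v)"
| "derivation (Plus a b) = Plus (derivation a) (derivation b)"
| "derivation (Times a b) =
     Plus (Times (derivation a) (map_trm Base b)) (Times (map_trm Base a) (derivation b))"

primrec subst_sym :: "'v list \<Rightarrow> 'v trm list \<Rightarrow> 'v sym \<Rightarrow> 'v trm" where
  "subst_sym xs \<theta>s (Base v) = Var v"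
| "subst_sym xs \<theta>s (Prime v) =
     (case map_of (zip xs \<theta>s) v of Some \<theta> \<Rightarrow> \<theta> | None \<Rightarrow> Const 0)"

primrec subst_diff :: "'v list \<Rightarrow> 'v trm list \<Rightarrow> 'v sym trm \<Rightarrow> 'v trm" where
  "subst_diff xs \<theta>s (Const r) = Const r"
| "subst_diff xs \<theta>s (Var w) = subst_sym xs \<theta>s w"
| "subst_diff xs \<theta>s (Plus a b) = Plus (subst_diff xs \<theta>s a) (subst_diff xs \<theta>s b)"
| "subst_diff xs \<theta>s (Times a b) = Times (subst_diff xs \<theta>s a) (subst_diff xs \<theta>s b)"

datatype 'v fol =
    Geq "'v trm" "'v trm"
  | Neg "'v fol"
  | Conj "'v fol" "'v fol"
  | Exi 'v "'v fol"

abbreviation Leq :: "'v trm \<Rightarrow> 'v trm \<Rightarrow> 'v fol" where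
  "Leq a b \<equiv> Geq b a"

abbreviation Greater :: "'v trm \<Rightarrow> 'v trm \<Rightarrow> 'v fol" where
  "Greater a b \<equiv> Neg (Geq b a)"

abbreviation Imp :: "'v fol \<Rightarrow> 'v fol \<Rightarrow> 'v fol" where
  "Imp \<phi> \<psi> \<equiv> Neg (Conj \<phi> (Neg \<psi>))"

definition Exists_vec :: "'v list \<Rightarrow> 'v fol \<Rightarrow> 'v fol" where
  "Exists_vec vs \<phi> = foldr Exi vs \<phi>"

definition Forall_vec :: "'v list \<Rightarrow> 'v fol \<Rightarrow> 'v fol" where
  "Forall_vec vs \<phi> = foldr (\<lambda>v \<psi>. Neg (Exi v (Neg \<psi>))) vs \<phi>"

primrec fol_fv :: "'v fol \<Rightarrow> 'v set" where
  "fol_fv (Geq a b) = set_trm a \<union> set_trm b"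
| "fol_fv (Neg \<phi>) = fol_fv \<phi>"
| "fol_fv (Conj \<phi> \<psi>) = fol_fv \<phi> \<union> fol_fv \<psi>"
| "fol_fv (Exi v \<phi>) = fol_fv \<phi> - {v}"

primrec fol_true :: "'v fol \<Rightarrow> 'v state \<Rightarrow> bool" where
  "fol_true (Geq a b) \<omega> \<longleftrightarrow> trm_val a \<omega> \<ge> trm_val b \<omega>"
| "fol_true (Neg \<phi>) \<omega> \<longleftrightarrow> \<not> fol_true \<phi> \<omega>"
| "fol_true (Conj \<phi> \<psi>) \<omega> \<longleftrightarrow> fol_true \<phi> \<omega> \<and> fol_true \<psi> \<omega>"
| "fol_true (Exi v \<phi>) \<omega> \<longleftrightarrow> (\<exists>r. fol_true \<phi> (fun_upd \<omega> v r))"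

text \<open>A point of the Euclidean space with coordinates named by the variable vector \<open>vs\<close> is a
  function in \<open>set vs \<rightarrow>\<^sub>E UNIV\<close>. The set below is the set defined by \<open>\<phi>\<close> when all free variables
  of \<open>\<phi>\<close> are among \<open>vs\<close>, as the values of other variables are then irrelevant.\<close>

definition defined_set :: "'v list \<Rightarrow> 'v fol \<Rightarrow> ('v \<Rightarrow> real) set" where
  "defined_set vs \<phi> = {p \<in> set vs \<rightarrow>\<^sub>E UNIV. fol_true \<phi> p}"

definition controls :: "real \<Rightarrow> 'v list \<Rightarrow> 'v fol \<Rightarrow> (real \<Rightarrow> 'v \<Rightarrow> real) set" where
  "controls T vs \<phi> =
     {u \<in> {0..T} \<rightarrow>\<^sub>E defined_set vs \<phi>.
        u \<in> lebesgue_on {0..T} \<rightarrow>\<^sub>M PiM (set vs) (\<lambda>_. borel)}"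

definition strategies ::
    "real \<Rightarrow> (real \<Rightarrow> 'v \<Rightarrow> real) set \<Rightarrow> (real \<Rightarrow> 'v \<Rightarrow> real) set
      \<Rightarrow> ((real \<Rightarrow> 'v \<Rightarrow> real) \<Rightarrow> real \<Rightarrow> 'v \<Rightarrow> real) set" where
  "strategies T MY MZ =
     {\<beta> \<in> MY \<rightarrow> MZ. \<forall>s\<in>{0..T}. \<forall>y\<in>MY. \<forall>y'\<in>MY.
        (AE t in lebesgue_on {0..s}. y t = y' t) \<longrightarrow>
        (AE t in lebesgue_on {0..s}. \<beta> y t = \<beta> y' t)}"

text \<open>Absolute continuity on an interval \<open>I\<close>; the cells of a division are non-overlapping
  compact intervals \<open>{Inf K..Sup K}\<close>.\<close>

definition abs_continuous_on :: "real set \<Rightarrow> (real \<Rightarrow> real) \<Rightarrow> bool" where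
  "abs_continuous_on I F \<longleftrightarrow>
     (\<forall>\<epsilon>>0. \<exists>\<delta>>0. \<forall>D S. D division_of S \<and> S \<subseteq> I \<and> (\<Sum>K\<in>D. Sup K - Inf K) < \<delta> \<longrightarrow>
        (\<Sum>K\<in>D. \<bar>F (Sup K) - F (Inf K)\<bar>) < \<epsilon>)"

definition caratheodory_solution ::
    "real \<Rightarrow> 'v list \<Rightarrow> 'v trm list \<Rightarrow> 'v list \<Rightarrow> (real \<Rightarrow> 'v \<Rightarrow> real)
      \<Rightarrow> 'v list \<Rightarrow> (real \<Rightarrow> 'v \<Rightarrow> real) \<Rightarrow> 'v state \<Rightarrow> (real \<Rightarrow> 'v \<Rightarrow> real) \<Rightarrow> bool" where
  "caratheodory_solution T xs fs ys y zs z \<omega> X \<longleftrightarrow>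
     X \<in> {0..T} \<rightarrow>\<^sub>E (set xs \<rightarrow>\<^sub>E UNIV) \<and>
     (\<forall>v\<in>set xs. X 0 v = \<omega> v) \<and>
     (\<forall>v\<in>set xs. abs_continuous_on {0..T} (\<lambda>s. X s v)) \<and>
     (AE s in lebesgue_on {0..T}. \<forall>i<length xs.
        ((\<lambda>t. X t (xs ! i)) has_real_derivative
          trm_val (fs ! i)
            (override_on (override_on (override_on \<omega> (X s) (set xs)) (y s) (set ys)) (z s) (set zs)))
        (at s within {0..T}))"

definition response ::
    "real \<Rightarrow> 'v list \<Rightarrow> 'v trm list \<Rightarrow> 'v list \<Rightarrow> (real \<Rightarrow> 'v \<Rightarrow> real)
      \<Rightarrow> 'v list \<Rightarrow> (real \<Rightarrow> 'v \<Rightarrow> real) \<Rightarrow> 'v state \<Rightarrow> real \<Rightarrow> 'v state" where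
  "response T xs fs ys y zs z \<omega> \<zeta> =
     override_on \<omega> ((THE X. caratheodory_solution T xs fs ys y zs z \<omega> X) \<zeta>) (set xs)"

text \<open>\<open>Diamond xs fs ys Y zs Z G\<close> is the formula
  \<open>\<langle>xs' = fs & ys \<in> Y & zs \<in> Z\<rangle> G\<close>.\<close>

datatype 'v fml =
    FO "'v fol"
  | Diamond "'v list" "'v trm list" "'v list" "'v fol" "'v list" "'v fol" "'v fml"

primrec fml_true :: "'v fml \<Rightarrow> 'v state \<Rightarrow> bool" where
  "fml_true (FO \<phi>) \<omega> \<longleftrightarrow> fol_true \<phi> \<omega>"
| "fml_true (Diamond xs fs ys Y zs Z G) \<omega> \<longleftrightarrow>
     (\<exists>T\<ge>0. \<exists>\<beta>\<in>strategies T (controls T ys Y) (controls T zs Z).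
        \<forall>y\<in>controls T ys Y. \<exists>\<zeta>\<in>{0..T}.
          fml_true G (response T xs fs ys y zs (\<beta> y) \<omega> \<zeta>))"

definition valid :: "'v fml \<Rightarrow> bool" where
  "valid \<phi> \<longleftrightarrow> (\<forall>\<omega>. fml_true \<phi> \<omega>)"

end

theory Submission
  imports Defs
begin

text \<open>Sampling the state at the times \<open>k * h\<close> and holding, on the next cell of length \<open>h\<close>, the
  control that the hypothesis provides for the sampled state is a nonanticipative strategy. As the
  right-hand sides are bounded, on a bounded time interval the state stays in a bounded set and
  moves little within a cell, so by local Lipschitz continuity of polynomials the derivative
  of \<open>g\<close> along the trajectory is still at least \<open>\<epsilon> / 2\<close> on every cell that starts with
  \<open>g \<le> 0\<close>. Hence \<open>g\<close> becomes nonnegative by time \<open>2 * \<bar>g\<bar> / \<epsilon> + 1\<close>.\<close>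

section \<open>Absolutely continuous functions\<close>

text \<open>The policy extracted from the hypothesis by choice need be neither continuous nor
  measurable in the state, so feeding it back continuously need not give an admissible control.
  Sampling uses only finitely many of its values. Only the control \<open>z\<close> is frozen: the
  hypothesis picks \<open>z\<close> before \<open>y\<close>, so the estimate at the sampled state
  covers every value that the opponent chooses later in the cell. \<open>response\<close> is defined
  by \<open>THE\<close>, so existence and uniqueness of Caratheodory solutions have to come first.
  Uniqueness on initial segments, for controls that agree only almost everywhere, is also what makes
  the sampled strategy nonanticipative. The constants are fixed in the order \<open>T\<close>, box,
  Lipschitz constant, step \<open>h\<close>. The guaranteed rate \<open>\<epsilon> / 2\<close>
  determines \<open>T\<close> in advance; the global bound on the right-hand side then confines all
  trajectories up to \<open>T\<close>, whatever the controls; only then is \<open>h\<close> chosen.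
  The growth estimate is run under the assumption that \<open>g\<close> stays negative up to
  \<open>T\<close>, so that every cell qualifies.\<close>

lemma AE_lebesgue_on_iff_negligible:
  assumes "S \<in> sets lebesgue"
  shows "(AE x in lebesgue_on S. P x) \<longleftrightarrow> negligible {x \<in> S. \<not> P x}"
proof -
  have "(AE x in lebesgue_on S. P x) \<longleftrightarrow> (AE x in lebesgue. x \<in> S \<longrightarrow> P x)"
    by (rule AE_restrict_space_iff) (use assms in simp)
  also have "\<dots> \<longleftrightarrow> negligible {x \<in> S. \<not> P x}"
    unfolding eventually_ae_filter_negligible by (auto intro: negligible_subset simp: Collect_conj_eq)
  finally show ?thesis .
qed

text \<open>Outer regularity bounds the measure of \<open>U - N\<close>; adding the null set
  \<open>N\<close> back costs nothing.\<close>

lemma negligible_outer_open: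
  assumes "negligible N" "0 < e"
  obtains U where "open U" "N \<subseteq> U" "U \<in> lmeasurable" "measure lebesgue U < e"
proof -
  obtain U where U: "open U" "N \<subseteq> U" "U - N \<in> lmeasurable" "emeasure lebesgue (U - N) < ennreal e"
    using sets_lebesgue_outer_open[OF negligible_imp_sets[OF assms(1)] assms(2)] by blast
  have eq: "U = (U - N) \<union> N" using U by auto
  have m: "U \<in> lmeasurable"
    using U(3) negligible_imp_measurable[OF assms(1)] eq by (metis fmeasurable.Un)
  have "measure lebesgue U = measure lebesgue (U - N)"
    by (subst eq, rule measure_Un_null_set)
       (use U(3) assms(1) in \<open>auto simp: negligible_iff_null_sets fmeasurableD\<close>)
  also have "\<dots> < e"
    using U(3,4) assms(2) by (simp add: emeasure_eq_measure2 ennreal_less_iff)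
  finally show ?thesis using U m that by blast
qed

text \<open>The gauge is dictated by differentiability off the null set \<open>N\<close>, and on \<open>N\<close> by an open
  superset of small measure, where absolute continuity controls the increments.\<close>

lemma abs_continuous_has_integral:
  fixes F u :: "real \<Rightarrow> real"
  assumes ab: "a \<le> b" and AC: "abs_continuous_on {a..b} F" and N: "negligible N"
    and der: "\<And>s. s \<in> {a..b} - N \<Longrightarrow> (F has_real_derivative u s) (at s within {a..b})"
  shows "(u has_integral F b - F a) {a..b}"
proof -
  \<comment> \<open>With the integrand zeroed on \<open>N\<close>, a cell tagged in \<open>N\<close>
    contributes only its increment of \<open>F\<close> to the error;
    \<open>has_integral_spike\<close> restores \<open>u\<close> at the end.\<close>
  define v where "v = (\<lambda>s. if s \<in> N then 0 else u s)"
  have "(v has_integral F b - F a) {a..b}"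
    unfolding has_integral_real
  proof (intro allI impI)
    fix e :: real assume e: "e > 0"
    obtain \<delta> where \<delta>: "\<delta> > 0"
      "\<And>D S. D division_of S \<Longrightarrow> S \<subseteq> {a..b} \<Longrightarrow> (\<Sum>K\<in>D. Sup K - Inf K) < \<delta> \<Longrightarrow>
         (\<Sum>K\<in>D. \<bar>F (Sup K) - F (Inf K)\<bar>) < e/2"
      using AC e unfolding abs_continuous_on_def by (meson half_gt_zero)
    obtain U where U: "open U" "N \<subseteq> U" "U \<in> lmeasurable" "measure lebesgue U < \<delta>"
      using negligible_outer_open[OF N \<delta>(1)] by blast
    \<comment> \<open>The tolerance is split in halves: tags off \<open>N\<close> cost at most
      \<open>\<eta> * (b - a)\<close>, tags in \<open>N\<close> less than \<open>e/2\<close>. The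
      \<open>+ 1\<close> covers \<open>a = b\<close>.\<close>
    define \<eta> where "\<eta> = e / (2 * (b - a + 1))"
    have \<eta>: "\<eta> > 0" using e ab by (simp add: \<eta>_def)
    have \<eta>e: "\<eta> * (b - a) \<le> e/2" using e ab by (simp add: \<eta>_def field_simps)
    have "\<forall>s\<in>{a..b} - N. \<exists>d. d>0 \<and> (\<forall>t\<in>{a..b}. \<bar>t - s\<bar> < d \<longrightarrow> \<bar>F t - F s - u s * (t - s)\<bar> \<le> \<eta> * \<bar>t - s\<bar>)"
    proof
      fix s assume "s \<in> {a..b} - N"
      from der[OF this] \<eta> show "\<exists>d. d>0 \<and> (\<forall>t\<in>{a..b}. \<bar>t - s\<bar> < d \<longrightarrow> \<bar>F t - F s - u s * (t - s)\<bar> \<le> \<eta> * \<bar>t - s\<bar>)"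
        unfolding has_field_derivative_def has_derivative_within_alt by simp
    qed
    from bchoice[OF this]
    obtain d where d: "\<And>s. s \<in> {a..b} - N \<Longrightarrow> d s > 0"
      "\<And>s t. s \<in> {a..b} - N \<Longrightarrow> t \<in> {a..b} \<Longrightarrow> \<bar>t - s\<bar> < d s \<Longrightarrow>
          \<bar>F t - F s - u s * (t - s)\<bar> \<le> \<eta> * \<bar>t - s\<bar>"
      by blast
    define \<gamma> where "\<gamma> = (\<lambda>s. if s \<in> N then U else if s \<in> {a..b} then ball s (d s) else UNIV)"
    have "gauge \<gamma>"
      using U d(1) by (auto simp: gauge_def \<gamma>_def)
    moreover have "norm ((\<Sum>(x,K)\<in>p. measure lborel K *\<^sub>R v x) - (F b - F a)) < e"
      if p: "p tagged_division_of {a..b}" and fine: "\<gamma> fine p" for p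
    proof -
      define q where "q = {(x,K) \<in> p. x \<in> N}"
      have fin: "finite p" using p by (rule tagged_division_of_finite)
      have qp: "q \<subseteq> p" by (auto simp: q_def)
      have K: "\<exists>c d. K = {c..d} \<and> a \<le> c \<and> c \<le> x \<and> x \<le> d \<and> d \<le> b" if xK: "(x,K) \<in> p" for x K
      proof -
        obtain c d where "K = cbox c d" using tagged_division_ofD(4)[OF p xK] by blast
        moreover have "x \<in> K" "K \<subseteq> {a..b}" using tagged_division_ofD(2,3)[OF p xK] by auto
        ultimately show ?thesis by auto
      qed
      have tp: "q tagged_partial_division_of {a..b}"
        using p qp tagged_partial_division_subset tagged_division_of_def by blast
      have td: "q tagged_division_of \<Union>(snd ` q)"
        using tp by (rule tagged_partial_division_of_Union_self)
      have dv: "(snd ` q) division_of \<Union>(snd ` q)"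
        using tp by (rule partial_division_of_tagged_division)
      have sub: "\<Union>(snd ` q) \<subseteq> {a..b}" "\<Union>(snd ` q) \<subseteq> U"
        using K qp fine by (fastforce simp: q_def fine_def \<gamma>_def)+
      have "(\<Sum>K\<in>snd ` q. Sup K - Inf K) = (\<Sum>K\<in>snd ` q. measure lebesgue K)"
        using K by (intro sum.cong) (fastforce simp: q_def)+
      also have "\<dots> = measure lebesgue (\<Union>(snd ` q))" using content_division[OF dv] .
      also have "\<dots> \<le> measure lebesgue U"
        by (rule measure_mono_fmeasurable[OF sub(2) fmeasurableD[OF lmeasurable_division[OF dv]] U(3)])
      finally have small: "(\<Sum>K\<in>snd ` q. \<bar>F (Sup K) - F (Inf K)\<bar>) < e/2"
        using \<delta>(2)[OF dv sub(1)] U(4) by simp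
      have qs: "(\<Sum>(x,K)\<in>q. \<bar>F (Sup K) - F (Inf K)\<bar>) = (\<Sum>K\<in>snd ` q. \<bar>F (Sup K) - F (Inf K)\<bar>)"
      proof -
        \<comment> \<open>Reindexing from tagged pairs to cells requires the value 0 on every box
          with empty interior. This includes the empty set, where \<open>Sup\<close> and
          \<open>Inf\<close> are unspecified.\<close>
        define h where "h = (\<lambda>K. if K = {} then 0 else \<bar>F (Sup K) - F (Inf K)\<bar>)"
        have ne: "K \<noteq> {}" if "(x,K) \<in> q" for x K using tagged_division_ofD(2)[OF p, of x K] that qp by auto
        have "(\<Sum>(x,K)\<in>q. \<bar>F (Sup K) - F (Inf K)\<bar>) = (\<Sum>(x,K)\<in>q. h K)"
          using ne by (intro sum.cong) (auto simp: h_def)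
        also have "\<dots> = (\<Sum>K\<in>snd ` q. h K)"
          using td
        proof (rule sum.over_tagged_division_lemma)
          fix c d :: real assume "box c d = {}"
          then show "h (cbox c d) = 0" by (cases "c = d") (auto simp: h_def)
        qed
        also have "\<dots> = (\<Sum>K\<in>snd ` q. \<bar>F (Sup K) - F (Inf K)\<bar>)"
          using ne by (intro sum.cong) (auto simp: h_def)
        finally show ?thesis .
      qed
      have e1: "(\<Sum>(x,K)\<in>p. measure lborel K *\<^sub>R v x) - (F b - F a)
           = (\<Sum>(x,K)\<in>p. measure lborel K * v x - (F (Sup K) - F (Inf K)))"
        using additive_tagged_division_1[OF ab p, of F]
        by (simp add: case_prod_beta sum_subtractf)
      have e2: "\<bar>\<Sum>(x,K)\<in>p. measure lborel K * v x - (F (Sup K) - F (Inf K))\<bar>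
          \<le> (\<Sum>(x,K)\<in>p. \<eta> * measure lborel K + (if x \<in> N then \<bar>F (Sup K) - F (Inf K)\<bar> else 0))"
      proof (rule order_trans[OF sum_abs], rule sum_mono, clarify)
        fix x K assume xK: "(x, K) \<in> p"
        obtain c d' where cd: "K = {c..d'}" "a \<le> c" "c \<le> x" "x \<le> d'" "d' \<le> b"
          using K[OF xK] by blast
        show "\<bar>measure lborel K * v x - (F (Sup K) - F (Inf K))\<bar>
            \<le> \<eta> * measure lborel K + (if x \<in> N then \<bar>F (Sup K) - F (Inf K)\<bar> else 0)"
        proof (cases "x \<in> N")
          case True
          then show ?thesis using mult_nonneg_nonneg[OF less_imp_le[OF \<eta>] measure_nonneg[of lborel K]]
            by (simp add: v_def)
        next
          case False
          then have x: "x \<in> {a..b} - N" using cd by auto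
          have "{c..d'} \<subseteq> ball x (d x)"
          proof -
            have "K \<subseteq> \<gamma> x" using fine xK by (auto simp: fine_def)
            then show ?thesis using x cd(1) by (simp add: \<gamma>_def)
          qed
          moreover have "c \<in> {c..d'}" "d' \<in> {c..d'}" using cd by auto
          ultimately have "c \<in> ball x (d x)" "d' \<in> ball x (d x)" by blast+
          then have "\<bar>c - x\<bar> < d x" "\<bar>d' - x\<bar> < d x"
            by (simp_all add: dist_real_def abs_minus_commute)
          \<comment> \<open>Straddle argument: the tag lies between the end points, so the two
            linearisation errors add up to a multiple of the length of the cell.\<close>
          then have "\<bar>F c - F x - u x * (c - x)\<bar> \<le> \<eta> * \<bar>c - x\<bar>"
            "\<bar>F d' - F x - u x * (d' - x)\<bar> \<le> \<eta> * \<bar>d' - x\<bar>"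
            using d(2)[OF x, of c] d(2)[OF x, of d'] cd by simp_all
          moreover have "\<eta> * \<bar>c - x\<bar> + \<eta> * \<bar>d' - x\<bar> = \<eta> * (d' - c)"
            using cd by (simp add: algebra_simps)
          moreover have "(d' - c) * u x - (F d' - F c)
            = (F c - F x - u x * (c - x)) - (F d' - F x - u x * (d' - x))"
            by (simp add: algebra_simps)
          ultimately have "\<bar>(d' - c) * u x - (F d' - F c)\<bar> \<le> \<eta> * (d' - c)"
            by linarith
          then show ?thesis using False cd by (simp add: v_def)
        qed
      qed
      have e3: "(\<Sum>(x,K)\<in>p. \<eta> * measure lborel K + (if x \<in> N then \<bar>F (Sup K) - F (Inf K)\<bar> else 0))
          = \<eta> * (\<Sum>(x,K)\<in>p. measure lborel K)
          + (\<Sum>(x,K)\<in>p. if x \<in> N then \<bar>F (Sup K) - F (Inf K)\<bar> else 0)"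
        by (simp add: case_prod_beta sum.distrib sum_distrib_left)
      have e4: "(\<Sum>(x,K)\<in>p. if x \<in> N then \<bar>F (Sup K) - F (Inf K)\<bar> else 0)
          = (\<Sum>(x,K)\<in>q. \<bar>F (Sup K) - F (Inf K)\<bar>)"
        using fin by (intro sum.mono_neutral_cong_right) (auto simp: q_def split: if_splits)
      have e5: "(\<Sum>(x,K)\<in>p. measure lborel K) = b - a"
        using additive_content_tagged_division[of p a b] p ab by simp
      have "\<bar>(\<Sum>(x,K)\<in>p. measure lborel K *\<^sub>R v x) - (F b - F a)\<bar> < e"
        using e2 small \<eta>e unfolding e1 e3 e4 e5 qs by linarith
      then show ?thesis by simp
    qed
    ultimately show "\<exists>\<gamma>. gauge \<gamma> \<and> (\<forall>p. p tagged_division_of {a..b} \<and> \<gamma> fine p \<longrightarrow>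
        norm ((\<Sum>(x,K)\<in>p. measure lborel K *\<^sub>R v x) - (F b - F a)) < e)"
      by (intro exI[of _ \<gamma>] conjI allI impI) simp_all
  qed
  then show ?thesis
    by (rule has_integral_spike[OF N, rotated]) (simp add: v_def)
qed

lemma lipschitz_imp_abs_continuous_on:
  assumes "M \<ge> 0" and "\<And>s t. s \<in> {a..b} \<Longrightarrow> t \<in> {a..b} \<Longrightarrow> \<bar>F s - F t\<bar> \<le> M * \<bar>s - t\<bar>"
  shows "abs_continuous_on {a..b::real} F"
  unfolding abs_continuous_on_def
proof (intro allI impI)
  fix e :: real assume e: "e > 0"
  show "\<exists>\<delta>>0. \<forall>D S. D division_of S \<and> S \<subseteq> {a..b} \<and> (\<Sum>K\<in>D. Sup K - Inf K) < \<delta> \<longrightarrow>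
        (\<Sum>K\<in>D. \<bar>F (Sup K) - F (Inf K)\<bar>) < e"
  proof (intro exI[of _ "e / (M + 1)"] conjI allI impI, goal_cases)
    case 1 then show ?case using assms e by simp
  next
    case (2 D S)
    have "\<bar>F (Sup K) - F (Inf K)\<bar> \<le> M * (Sup K - Inf K) \<and> Sup K - Inf K \<ge> 0" if "K \<in> D" for K
    proof -
      obtain c d where "K = cbox c d" "K \<noteq> {}" "K \<subseteq> {a..b}"
        using 2 division_ofD(2,3,4)[of D S K] \<open>K \<in> D\<close> by blast
      then show ?thesis using assms(2)[of d c] by auto
    qed
    then have "(\<Sum>K\<in>D. \<bar>F (Sup K) - F (Inf K)\<bar>) \<le> M * (\<Sum>K\<in>D. Sup K - Inf K)"
      "(\<Sum>K\<in>D. Sup K - Inf K) \<ge> 0"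
      by (auto simp: sum_distrib_left intro: sum_mono sum_nonneg)
    moreover have "(M + 1) * (\<Sum>K\<in>D. Sup K - Inf K) < e"
      using 2 assms(1) by (simp add: field_simps)
    ultimately show ?case by (simp add: algebra_simps)
  qed
qed

lemma abs_continuous_on_subset:
  "abs_continuous_on I F \<Longrightarrow> J \<subseteq> I \<Longrightarrow> abs_continuous_on J F"
  unfolding abs_continuous_on_def by (meson subset_trans)

lemma abs_continuous_on_imp_continuous_on:
  assumes "abs_continuous_on {a..b::real} F"
  shows "continuous_on {a..b} F"
  unfolding continuous_on_iff
proof (intro ballI allI impI)
  fix s e :: real assume s: "s \<in> {a..b}" and e: "e > 0"
  obtain \<delta> where \<delta>: "\<delta> > 0"
      "\<And>D S. D division_of S \<Longrightarrow> S \<subseteq> {a..b} \<Longrightarrow> (\<Sum>K\<in>D. Sup K - Inf K) < \<delta> \<Longrightarrow>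
         (\<Sum>K\<in>D. \<bar>F (Sup K) - F (Inf K)\<bar>) < e"
    using assms e unfolding abs_continuous_on_def by meson
  have *: "\<bar>F d - F c\<bar> < e" if "a \<le> c" "c \<le> d" "d \<le> b" "d - c < \<delta>" for c d
    using \<delta>(2)[of "{{c..d}}" "{c..d}"] that division_of_self[of c d] by auto
  show "\<exists>d>0. \<forall>x'\<in>{a..b}. dist x' s < d \<longrightarrow> dist (F x') (F s) < e"
  proof (intro exI[of _ \<delta>] conjI ballI impI \<delta>(1))
    fix t assume "t \<in> {a..b}" "dist t s < \<delta>"
    then show "dist (F t) (F s) < e"
      using *[of s t] *[of t s] s by (cases "s \<le> t") (auto simp: dist_real_def abs_minus_commute)
  qed
qed

section \<open>Initial value problems with measurable right-hand side\<close>

text \<open>Lebesgue differentiation. \<open>integrable_ccontinuous_explicit\<close> controls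
  forward difference quotients; applied to the reflected integrand \<open>f (- x)\<close> it
  controls the backward ones.\<close>

lemma integral_AE_has_derivative:
  fixes u :: "real \<Rightarrow> real"
  assumes u: "u integrable_on {a..b}"
  obtains N where "negligible N"
    "\<And>s. s \<in> {a..b} - N \<Longrightarrow>
      ((\<lambda>t. integral {a..t} u) has_real_derivative u s) (at s within {a..b})"
proof -
  \<comment> \<open>Extension by zero, because \<open>integrable_ccontinuous_explicit\<close> asks
    for integrability on every interval.\<close>
  define f where "f = (\<lambda>s. if s \<in> {a..b} then u s else 0)"
  have "f integrable_on UNIV" unfolding f_def using u integrable_restrict_UNIV by blast
  then have f: "f integrable_on {c..d}" for c d
    using integrable_on_subcbox[of f UNIV c d] by simp
  have fr: "(\<lambda>x. f (- x)) integrable_on {c..d}" for c d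
    using f[of "- d" "- c"] Henstock_Kurzweil_Integration.integrable_reflect_real[where f=f and a="- d" and b="- c"] by simp
  obtain N1 where N1: "negligible N1" "\<And>x e. x \<notin> N1 \<Longrightarrow> 0 < e \<Longrightarrow>
      \<exists>d>0. \<forall>h. 0 < h \<and> h < d \<longrightarrow> norm (integral {x..x + h} f / h - f x) < e"
    by (rule integrable_ccontinuous_explicit[of f]) (auto simp: f divide_inverse mult.commute)
  obtain N2 where N2: "negligible N2" "\<And>x e. x \<notin> N2 \<Longrightarrow> 0 < e \<Longrightarrow>
      \<exists>d>0. \<forall>h. 0 < h \<and> h < d \<longrightarrow> norm (integral {x..x + h} (\<lambda>x. f (- x)) / h - f (- x)) < e"
    by (rule integrable_ccontinuous_explicit[of "\<lambda>x. f (- x)"]) (auto simp: fr divide_inverse mult.commute)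
  define N where "N = N1 \<union> uminus ` N2 \<union> {a, b}"
  have "negligible (uminus ` N2)"
    by (rule negligible_differentiable_image_negligible)
       (auto simp: N2 intro!: differentiable_on_minus differentiable_on_ident)
  then have "negligible N" using N1 by (simp add: N_def)
  moreover have "((\<lambda>t. integral {a..t} u) has_real_derivative u s) (at s within {a..b})"
    if s: "s \<in> {a..b} - N" for s
    unfolding has_field_derivative_iff LIM_def tendsto_iff eventually_at
  proof (intro allI impI)
    fix e :: real assume e: "e > 0"
    have s': "s \<notin> N1" "- s \<notin> N2" "a < s" "s < b"
      using s by (auto simp: N_def image_iff)
    obtain d1 where d1: "d1 > 0" "\<And>h. 0 < h \<Longrightarrow> h < d1 \<Longrightarrow> \<bar>integral {s..s + h} f / h - f s\<bar> < e"
      using N1(2)[OF s'(1) e] by auto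
    obtain d2 where d2: "d2 > 0"
      "\<And>h. 0 < h \<Longrightarrow> h < d2 \<Longrightarrow> \<bar>integral {- s..- s + h} (\<lambda>x. f (- x)) / h - f s\<bar> < e"
      using N2(2)[OF s'(2) e] by auto
    have eq: "integral {c..d} f = integral {c..d} u" if "a \<le> c" "d \<le> b" for c d
      using that by (intro integral_cong) (auto simp: f_def)
    have fs: "f s = u s" using s by (simp add: f_def)
    have ui: "u integrable_on {a..c}" if "c \<le> b" for c
      using u by (rule integrable_on_subinterval) (use that in auto)
    show "\<exists>d>0. \<forall>x\<in>{a..b}. x \<noteq> s \<and> dist x s < d \<longrightarrow>
        dist ((integral {a..x} u - integral {a..s} u) / (x - s)) (u s) < e"
    proof (intro exI[of _ "min d1 d2"] conjI ballI impI)
      fix x assume x: "x \<in> {a..b}" "x \<noteq> s \<and> dist x s < min d1 d2"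
      show "dist ((integral {a..x} u - integral {a..s} u) / (x - s)) (u s) < e"
      proof (cases "s < x")
        case True
        have "integral {a..s} u + integral {s..x} u = integral {a..x} u"
          using True s x ui by (intro Henstock_Kurzweil_Integration.integral_combine) auto
        then have "integral {a..x} u - integral {a..s} u = integral {s..x} u" by simp
        then show ?thesis
          using d1(2)[of "x - s"] x True eq[of s x] s fs by (auto simp: dist_real_def)
      next
        case False
        then have xs: "x < s" using x by auto
        have "integral {a..x} u + integral {x..s} u = integral {a..s} u"
          using xs s x ui by (intro Henstock_Kurzweil_Integration.integral_combine) auto
        then have "integral {a..s} u - integral {a..x} u = integral {x..s} u" by simp
        moreover have "integral {- s..- s + (s - x)} (\<lambda>x. f (- x)) = integral {x..s} u"
          using integral_reflect_real[where f=f and a=x and b=s] eq[of x s] s x by simp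
        ultimately have "\<bar>(integral {a..s} u - integral {a..x} u) / (s - x) - u s\<bar> < e"
          using d2(2)[of "s - x"] x xs fs by (auto simp: dist_real_def)
        moreover have "(integral {a..x} u - integral {a..s} u) / (x - s)
            = (integral {a..s} u - integral {a..x} u) / (s - x)"
          using xs by (simp add: field_simps)
        ultimately show ?thesis by (simp add: dist_real_def)
      qed
    qed (use d1 d2 in auto)
  qed
  ultimately show ?thesis by (rule that)
qed

lemma integral_lipschitz:
  fixes u :: "real \<Rightarrow> real"
  assumes u: "u integrable_on {0..T}" and M: "M \<ge> 0" "\<And>s. s \<in> {0..T} \<Longrightarrow> \<bar>u s\<bar> \<le> M"
    and st: "s \<in> {0..T}" "t \<in> {0..T}"
  shows "\<bar>integral {0..s} u - integral {0..t} u\<bar> \<le> M * \<bar>s - t\<bar>"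
proof -
  have *: "\<bar>integral {0..d} u - integral {0..c} u\<bar> \<le> M * (d - c)"
    if "0 \<le> c" "c \<le> d" "d \<le> T" for c d
  proof -
    have ui: "u integrable_on {c'..d}" if "0 \<le> c'" for c'
      using u by (rule integrable_on_subinterval) (use that \<open>d \<le> T\<close> in auto)
    have "integral {0..c} u + integral {c..d} u = integral {0..d} u"
      using that ui by (intro Henstock_Kurzweil_Integration.integral_combine) auto
    moreover have "norm (integral (cbox c d) u) \<le> M * measure lborel (cbox c d)"
      using ui[of c] M that by (intro integrable_bound) auto
    ultimately show ?thesis using that by simp
  qed
  show ?thesis
    using *[of s t] *[of t s] st by (cases "s \<le> t") (auto simp: abs_minus_commute)
qed

lemma geometric_Cauchy_limit:
  fixes f :: "nat \<Rightarrow> real"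
  assumes "\<And>k. \<bar>f (Suc k) - f k\<bar> \<le> C / 2 ^ k"
  obtains l where "\<And>k. \<bar>f k - l\<bar> \<le> 2 * C / 2 ^ k"
proof -
  \<comment> \<open>The bound is the exact geometric partial sum; keeping the subtracted tail is
    what lets the induction close.\<close>
  have *: "\<bar>f (k + n) - f k\<bar> \<le> 2 * C / 2 ^ k - 2 * C / 2 ^ (k + n)" for k n
  proof (induction n)
    case (Suc n)
    have "\<bar>f (k + Suc n) - f k\<bar> \<le> \<bar>f (Suc (k + n)) - f (k + n)\<bar> + \<bar>f (k + n) - f k\<bar>" by simp
    also have "\<dots> \<le> C / 2 ^ (k + n) + (2 * C / 2 ^ k - 2 * C / 2 ^ (k + n))"
      using assms[of "k + n"] Suc by linarith
    also have "\<dots> = 2 * C / 2 ^ k - 2 * C / 2 ^ (k + Suc n)"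
      by (simp add: field_simps)
    finally show ?case .
  qed simp
  have C: "C \<ge> 0" using assms[of 0] by simp
  have **: "\<bar>f (k + n) - f k\<bar> \<le> 2 * C / 2 ^ k" for k n
  proof -
    have "0 \<le> 2 * C / 2 ^ (k + n)" using C by (intro divide_nonneg_nonneg) simp_all
    then show ?thesis using *[of k n] by linarith
  qed
  have lim0: "(\<lambda>k. 2 * C / 2 ^ k) \<longlonglongrightarrow> 0"
    by (rule LIMSEQ_divide_realpow_zero) simp
  have "Cauchy f"
  proof (rule CauchyI')
    fix e :: real assume "0 < e"
    then obtain k where k: "2 * C / 2 ^ k < e / 2"
      using order_tendstoD(2)[OF lim0, of "e/2"] by (auto simp: eventually_sequentially)
    show "\<exists>M. \<forall>m\<ge>M. \<forall>n>m. dist (f m) (f n) < e"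
    proof (intro exI allI impI)
      fix m n assume "k \<le> m" "m < n"
      then show "dist (f m) (f n) < e"
        using **[of k "m - k"] **[of k "n - k"] k by (simp add: dist_real_def)
    qed
  qed
  then obtain l where l: "f \<longlonglongrightarrow> l" using Cauchy_convergent convergent_def by blast
  have "\<bar>f k - l\<bar> \<le> 2 * C / 2 ^ k" for k
  proof (rule LIMSEQ_le_const2)
    show "(\<lambda>n. \<bar>f k - f n\<bar>) \<longlonglongrightarrow> \<bar>f k - l\<bar>" by (intro tendsto_intros l)
    show "\<exists>N. \<forall>n\<ge>N. \<bar>f k - f n\<bar> \<le> 2 * C / 2 ^ k"
    proof (intro exI[of _ k] allI impI)
      fix n assume "k \<le> n"
      then show "\<bar>f k - f n\<bar> \<le> 2 * C / 2 ^ k" using **[of k "n - k"] by (simp add: abs_minus_commute)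
    qed
  qed
  then show ?thesis by (rule that)
qed

text \<open>Turns estimates with geometrically small error into exact ones; uniqueness and each
  passage to the limit of the Picard iterates end with it.\<close>

lemma nonpos_if_le_geometric:
  fixes x :: real
  assumes "\<And>k. x \<le> C / 2 ^ k"
  shows "x \<le> 0"
proof (rule LIMSEQ_le_const[of "\<lambda>k. C / 2 ^ k"])
  show "(\<lambda>k. C / 2 ^ k) \<longlonglongrightarrow> 0"
    by (rule LIMSEQ_divide_realpow_zero) simp
qed (intro exI allI impI assms)

text \<open>The bound confines solutions to the box on which \<open>F\<close> is Lipschitz. The weight
  \<open>exp (2 * L * s)\<close> makes the Picard operator a contraction with factor \<open>1/2\<close> on all of
  \<open>{0..T}\<close>.\<close>

locale bounded_lipschitz_ivp =
  fixes I :: "'v set" and T M L :: real and x0 :: "'v \<Rightarrow> real"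
    and F :: "'v \<Rightarrow> real \<Rightarrow> ('v \<Rightarrow> real) \<Rightarrow> real"
  assumes T: "0 \<le> T" and M: "0 \<le> M" and L: "0 < L"
    and bound: "\<And>v s x. v \<in> I \<Longrightarrow> s \<in> {0..T} \<Longrightarrow> \<bar>F v s x\<bar> \<le> M"
    and lipschitz: "\<And>v s x x' d. v \<in> I \<Longrightarrow> s \<in> {0..T} \<Longrightarrow>
      (\<And>w. w \<in> I \<Longrightarrow> \<bar>x w - x0 w\<bar> \<le> M * T) \<Longrightarrow> (\<And>w. w \<in> I \<Longrightarrow> \<bar>x' w - x0 w\<bar> \<le> M * T) \<Longrightarrow>
      (\<And>w. w \<in> I \<Longrightarrow> \<bar>x w - x' w\<bar> \<le> d) \<Longrightarrow> \<bar>F v s x - F v s x'\<bar> \<le> L * d"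
    and measurable: "\<And>v X. v \<in> I \<Longrightarrow> (\<And>w. w \<in> I \<Longrightarrow> continuous_on {0..T} (\<lambda>s. X s w)) \<Longrightarrow>
      (\<lambda>s. F v s (X s)) \<in> borel_measurable (lebesgue_on {0..T})"
begin

text \<open>The integral form makes solutions the continuous fixed points of \<open>picard\<close>.
  Values outside \<open>I\<close> and \<open>{0..T}\<close> are left free, so uniqueness is claimed
  only inside.\<close>

definition solution :: "(real \<Rightarrow> 'v \<Rightarrow> real) \<Rightarrow> bool" where
  "solution X \<longleftrightarrow> (\<forall>v\<in>I. continuous_on {0..T} (\<lambda>s. X s v)) \<and>
     (\<forall>v\<in>I. \<forall>t\<in>{0..T}. X t v = x0 v + integral {0..t} (\<lambda>s. F v s (X s)))"

definition picard :: "(real \<Rightarrow> 'v \<Rightarrow> real) \<Rightarrow> real \<Rightarrow> 'v \<Rightarrow> real" where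
  "picard X t v = x0 v + integral {0..t} (\<lambda>s. F v s (X s))"

context
  fixes X :: "real \<Rightarrow> 'v \<Rightarrow> real"
  assumes cont: "\<And>v. v \<in> I \<Longrightarrow> continuous_on {0..T} (\<lambda>s. X s v)"
begin

lemma rhs_integrable:
  assumes "v \<in> I" "t \<in> {0..T}"
  shows "(\<lambda>s. F v s (X s)) integrable_on {0..t}"
proof -
  have "(\<lambda>s. F v s (X s)) integrable_on {0..T}"
  proof (rule measurable_bounded_by_integrable_imp_integrable)
    show "(\<lambda>s. M) integrable_on {0..T}" by (rule integrable_const_ivl)
  qed (use measurable[OF assms(1) cont] bound assms in auto)
  then show ?thesis by (rule integrable_on_subinterval) (use assms in auto)
qed

lemma picard_lipschitz:
  assumes "v \<in> I" "s \<in> {0..T}" "t \<in> {0..T}"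
  shows "\<bar>picard X s v - picard X t v\<bar> \<le> M * \<bar>s - t\<bar>"
  using integral_lipschitz[of "\<lambda>s. F v s (X s)" T M s t] rhs_integrable[of v T] assms T M bound
  by (simp add: picard_def)

lemma picard_continuous:
  assumes "v \<in> I" shows "continuous_on {0..T} (\<lambda>s. picard X s v)"
  by (rule abs_continuous_on_imp_continuous_on, rule lipschitz_imp_abs_continuous_on[OF M])
     (use picard_lipschitz assms in auto)

text \<open>\<open>bound\<close> is global, so \<open>X\<close> itself may leave the box. Hence
  every fixed point lies in the box on which \<open>lipschitz\<close> is available.\<close>

lemma picard_box:
  assumes "v \<in> I" "t \<in> {0..T}" shows "\<bar>picard X t v - x0 v\<bar> \<le> M * T"
proof -
  have "\<bar>picard X t v - picard X 0 v\<bar> \<le> M * \<bar>t - 0\<bar>"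
    using assms T by (intro picard_lipschitz) auto
  also have "\<dots> \<le> M * T" using assms M by (intro mult_left_mono) auto
  finally show ?thesis by (simp add: picard_def)
qed

text \<open>One application halves the distance in the weighted sup norm. Integrability along
  \<open>X'\<close> is a hypothesis because the context grants continuity for \<open>X\<close>
  only.\<close>

lemma picard_contraction:
  assumes box: "\<And>v s. v \<in> I \<Longrightarrow> s \<in> {0..T} \<Longrightarrow> \<bar>X s v - x0 v\<bar> \<le> M * T"
    and box': "\<And>v s. v \<in> I \<Longrightarrow> s \<in> {0..T} \<Longrightarrow> \<bar>X' s v - x0 v\<bar> \<le> M * T"
    and close: "\<And>v s. v \<in> I \<Longrightarrow> s \<in> {0..T} \<Longrightarrow> \<bar>X s v - X' s v\<bar> \<le> c * exp (2 * L * s)"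
    and c: "c \<ge> 0" and v: "v \<in> I" and t: "t \<in> {0..T}"
    and int': "(\<lambda>s. F v s (X' s)) integrable_on {0..t}"
  shows "\<bar>picard X t v - picard X' t v\<bar> \<le> c / 2 * exp (2 * L * t)"
proof -
  have int: "(\<lambda>s. F v s (X s)) integrable_on {0..t}" using rhs_integrable v t by blast
  \<comment> \<open>Origin of the factor 1/2: the weight has derivative \<open>2 * L\<close> times
    itself. The contribution of the lower limit is dropped later, being of favourable sign.\<close>
  have w: "((\<lambda>s. L * (c * exp (2 * L * s))) has_integral
      (c / 2 * exp (2 * L * t) - c / 2 * exp (2 * L * 0))) {0..t}"
    by (rule fundamental_theorem_of_calculus)
       (use t in \<open>auto intro!: derivative_eq_intros simp flip: has_real_derivative_iff_has_vector_derivative\<close>)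
  have "picard X t v - picard X' t v = integral {0..t} (\<lambda>s. F v s (X s) - F v s (X' s))"
    using int int' by (simp add: picard_def integral_diff)
  also have "norm \<dots> \<le> integral {0..t} (\<lambda>s. L * (c * exp (2 * L * s)))"
  proof (rule integral_norm_bound_integral)
    fix s assume s: "s \<in> {0..t}"
    then have "s \<in> {0..T}" using t by auto
    then show "norm (F v s (X s) - F v s (X' s)) \<le> L * (c * exp (2 * L * s))"
      using lipschitz[OF v, of s "X s" "X' s" "c * exp (2 * L * s)"] box box' close by simp
  qed (use int int' w in \<open>auto intro: integrable_diff\<close>)
  also have "\<dots> \<le> c / 2 * exp (2 * L * t)"
    using integral_unique[OF w] c by simp
  finally show ?thesis by simp
qed

end

section \<open>Existence and uniqueness for the integral equation\<close>

lemma solution_iff_picard: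
  "solution X \<longleftrightarrow> (\<forall>v\<in>I. continuous_on {0..T} (\<lambda>s. X s v)) \<and>
     (\<forall>v\<in>I. \<forall>t\<in>{0..T}. X t v = picard X t v)"
  by (simp add: solution_def picard_def)

lemma solution_lipschitz:
  assumes "solution X" "v \<in> I" "s \<in> {0..T}" "t \<in> {0..T}"
  shows "\<bar>X s v - X t v\<bar> \<le> M * \<bar>s - t\<bar>"
  using assms picard_lipschitz[of X v s t] by (auto simp: solution_iff_picard)

lemma solution_box:
  assumes "solution X" "v \<in> I" "t \<in> {0..T}" shows "\<bar>X t v - x0 v\<bar> \<le> M * T"
  using assms picard_box[of X v t] by (auto simp: solution_iff_picard)

text \<open>The Picard operator reproduces both solutions, so their weighted distance can be halved
  any number of times, starting from the width \<open>2 * (M * T)\<close> of the box.\<close>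

lemma solution_unique:
  assumes X: "solution X" and X': "solution X'" and "v \<in> I" "t \<in> {0..T}"
  shows "X t v = X' t v"
proof -
  have cont: "\<And>v. v \<in> I \<Longrightarrow> continuous_on {0..T} (\<lambda>s. X s v)"
    and cont': "\<And>v. v \<in> I \<Longrightarrow> continuous_on {0..T} (\<lambda>s. X' s v)"
    using X X' by (auto simp: solution_def)
  define C where "C = 2 * (M * T)"
  have C: "C \<ge> 0" using M T by (simp add: C_def)
  have *: "\<forall>v\<in>I. \<forall>s\<in>{0..T}. \<bar>X s v - X' s v\<bar> \<le> C / 2 ^ k * exp (2 * L * s)" for k
  proof (induction k)
    case 0
    show ?case
    proof (intro ballI)
      fix v s assume vs: "v \<in> I" "s \<in> {0..T}"
      have "\<bar>X s v - X' s v\<bar> \<le> C * 1"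
        using solution_box[OF X vs] solution_box[OF X' vs] by (simp add: C_def)
      also have "\<dots> \<le> C * exp (2 * L * s)"
        using C L vs by (intro mult_left_mono) auto
      finally show "\<bar>X s v - X' s v\<bar> \<le> C / 2 ^ 0 * exp (2 * L * s)" by simp
    qed
  next
    case (Suc k)
    show ?case
    proof (intro ballI)
      fix v s assume vs: "v \<in> I" "s \<in> {0..T}"
      have "\<bar>picard X s v - picard X' s v\<bar> \<le> C / 2 ^ k / 2 * exp (2 * L * s)"
        using Suc C vs solution_box[OF X] solution_box[OF X'] cont cont' rhs_integrable[of X']
        by (intro picard_contraction) auto
      moreover have "X s v = picard X s v" "X' s v = picard X' s v"
        using X X' vs by (auto simp: solution_iff_picard)
      ultimately show "\<bar>X s v - X' s v\<bar> \<le> C / 2 ^ Suc k * exp (2 * L * s)"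
        by (simp add: mult.commute)
    qed
  qed
  have "\<bar>X t v - X' t v\<bar> \<le> C * exp (2 * L * t) / 2 ^ k" for k
    using *[of k] assms(3,4) by auto
  then have "\<bar>X t v - X' t v\<bar> \<le> 0" by (rule nonpos_if_le_geometric)
  then show ?thesis by simp
qed

lemma solution_exists: "\<exists>X. solution X"
proof -
  define P where "P k = (picard ^^ k) (\<lambda>t. x0)" for k
  have P0: "P 0 = (\<lambda>t. x0)" and PS: "P (Suc k) = picard (P k)" for k by (auto simp: P_def)
  have cont: "v \<in> I \<Longrightarrow> continuous_on {0..T} (\<lambda>s. P k s v)" for k v
    by (induction k arbitrary: v) (auto simp: P0 PS picard_continuous)
  have box: "\<bar>P k s v - x0 v\<bar> \<le> M * T" if "v \<in> I" "s \<in> {0..T}" for k s v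
    using that M T cont by (cases k) (auto simp: P0 PS picard_box)
  have lip: "\<bar>P k s v - P k t v\<bar> \<le> M * \<bar>s - t\<bar>" if "v \<in> I" "s \<in> {0..T}" "t \<in> {0..T}" for k s t v
    using that M cont by (cases k) (auto simp: P0 PS picard_lipschitz)
  define C where "C = M * T"
  have C: "C \<ge> 0" using M T by (simp add: C_def)
  have step: "\<forall>v\<in>I. \<forall>s\<in>{0..T}. \<bar>P (Suc k) s v - P k s v\<bar> \<le> C / 2 ^ k * exp (2 * L * s)" for k
  proof (induction k)
    case 0
    show ?case
    proof (intro ballI)
      fix v s assume vs: "v \<in> I" "s \<in> {0..T}"
      have "\<bar>P (Suc 0) s v - P 0 s v\<bar> \<le> C * 1"
        using box[OF vs, of "Suc 0"] by (simp add: C_def P0)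
      also have "\<dots> \<le> C * exp (2 * L * s)"
        using C L vs by (intro mult_left_mono) auto
      finally show "\<bar>P (Suc 0) s v - P 0 s v\<bar> \<le> C / 2 ^ 0 * exp (2 * L * s)" by simp
    qed
  next
    case (Suc k)
    show ?case
    proof (intro ballI)
      fix v s assume vs: "v \<in> I" "s \<in> {0..T}"
      have "\<bar>picard (P (Suc k)) s v - picard (P k) s v\<bar> \<le> C / 2 ^ k / 2 * exp (2 * L * s)"
        using Suc C vs box cont rhs_integrable[of "P k"]
        by (intro picard_contraction) auto
      then show "\<bar>P (Suc (Suc k)) s v - P (Suc k) s v\<bar> \<le> C / 2 ^ Suc k * exp (2 * L * s)"
        unfolding PS[of "Suc k"] PS[of k] by (simp add: mult.commute)
    qed
  qed
  \<comment> \<open>The weight is replaced by its value at \<open>T\<close>, its maximum, to get one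
    geometric rate for all times.\<close>
  define E where "E = C * exp (2 * L * T)"
  have E: "E \<ge> 0" using C by (simp add: E_def)
  have lim: "\<exists>l. \<forall>k. \<bar>P k s v - l\<bar> \<le> 2 * E / 2 ^ k" if vs: "v \<in> I" "s \<in> {0..T}" for s v
  proof (rule geometric_Cauchy_limit[of "\<lambda>k. P k s v" E])
    fix k
    have "\<bar>P (Suc k) s v - P k s v\<bar> \<le> C / 2 ^ k * exp (2 * L * s)" using step vs by blast
    also have "\<dots> \<le> C / 2 ^ k * exp (2 * L * T)"
      using C L vs by (intro mult_left_mono) auto
    finally show "\<bar>P (Suc k) s v - P k s v\<bar> \<le> E / 2 ^ k" by (simp add: E_def)
  qed blast
  obtain X where X: "\<And>s v k. v \<in> I \<Longrightarrow> s \<in> {0..T} \<Longrightarrow> \<bar>P k s v - X s v\<bar> \<le> 2 * E / 2 ^ k"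
  proof -
    have "\<forall>s v. \<exists>l. v \<in> I \<and> s \<in> {0..T} \<longrightarrow> (\<forall>k. \<bar>P k s v - l\<bar> \<le> 2 * E / 2 ^ k)"
      using lim by blast
    then obtain X where "\<forall>s v. v \<in> I \<and> s \<in> {0..T} \<longrightarrow> (\<forall>k. \<bar>P k s v - X s v\<bar> \<le> 2 * E / 2 ^ k)"
      unfolding choice_iff by blast
    then show ?thesis by (intro that[of X]) blast
  qed
  \<comment> \<open>The Lipschitz constant \<open>M\<close> is common to all iterates and so
    survives the limit; it yields the continuity under which the right-hand side is integrable along
    \<open>X\<close>.\<close>
  have Xlip: "\<bar>X s v - X t v\<bar> \<le> M * \<bar>s - t\<bar>" if "v \<in> I" "s \<in> {0..T}" "t \<in> {0..T}" for s t v
  proof -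
    have "\<bar>X s v - X t v\<bar> - M * \<bar>s - t\<bar> \<le> (4 * E) / 2 ^ k" for k
      using X[OF that(1,2), of k] X[OF that(1,3), of k] lip[OF that, of k] by linarith
    from nonpos_if_le_geometric[OF this] show ?thesis by simp
  qed
  have Xcont: "continuous_on {0..T} (\<lambda>s. X s v)" if "v \<in> I" for v
    by (rule abs_continuous_on_imp_continuous_on, rule lipschitz_imp_abs_continuous_on[OF M])
       (use Xlip that in auto)
  have Xbox: "\<bar>X s v - x0 v\<bar> \<le> M * T" if "v \<in> I" "s \<in> {0..T}" for s v
  proof -
    have "\<bar>X s v - x0 v\<bar> - M * T \<le> (2 * E) / 2 ^ k" for k
      using X[OF that, of k] box[OF that, of k] by linarith
    from nonpos_if_le_geometric[OF this] show ?thesis by simp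
  qed
  have "X t v = picard X t v" if vt: "v \<in> I" "t \<in> {0..T}" for v t
  proof -
    \<comment> \<open>Both terms are compared with iterate \<open>k + 1\<close>: it is close to
      \<open>X\<close> by convergence, and close to \<open>picard X\<close> by contraction from
      iterate \<open>k\<close>.\<close>
    have "\<bar>X t v - picard X t v\<bar> \<le> (2 * E + E * exp (2 * L * t)) / 2 ^ k" for k
    proof -
      have "\<bar>picard (P k) t v - picard X t v\<bar> \<le> (2 * E / 2 ^ k) / 2 * exp (2 * L * t)"
      proof (rule picard_contraction)
        fix w s assume ws: "w \<in> I" "s \<in> {0..T}"
        have "\<bar>P k s w - X s w\<bar> \<le> 2 * E / 2 ^ k * 1" using X[OF ws] by simp
        also have "\<dots> \<le> 2 * E / 2 ^ k * exp (2 * L * s)"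
          using E L ws by (intro mult_left_mono) auto
        finally show "\<bar>P k s w - X s w\<bar> \<le> 2 * E / 2 ^ k * exp (2 * L * s)" .
      qed (use cont Xcont box Xbox E vt rhs_integrable[of X] in auto)
      moreover have "\<bar>picard (P k) t v - X t v\<bar> \<le> 2 * E / 2 ^ Suc k"
        using X[OF vt, of "Suc k"] by (simp add: PS)
      moreover have "2 * E / 2 ^ Suc k \<le> 2 * E / 2 ^ k"
        using E by (intro divide_left_mono) auto
      ultimately have "\<bar>X t v - picard X t v\<bar> \<le> 2 * E / 2 ^ k + (2 * E / 2 ^ k) / 2 * exp (2 * L * t)"
        by linarith
      also have "\<dots> = (2 * E + E * exp (2 * L * t)) / 2 ^ k" by (simp add: field_simps)
      finally show ?thesis .
    qed
    from nonpos_if_le_geometric[OF this] show ?thesis by simp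
  qed
  then have "solution X" using Xcont by (simp add: solution_iff_picard)
  then show ?thesis by blast
qed

end

section \<open>Terms and formulas\<close>

lemma trm_val_cong:
  "(\<And>v. v \<in> set_trm \<theta> \<Longrightarrow> \<nu> v = \<nu>' v) \<Longrightarrow> trm_val \<theta> \<nu> = trm_val \<theta> \<nu>'"
  by (induction \<theta>) auto

lemma fol_true_cong:
  "(\<And>v. v \<in> fol_fv \<phi> \<Longrightarrow> \<nu> v = \<nu>' v) \<Longrightarrow> fol_true \<phi> \<nu> = fol_true \<phi> \<nu>'"
proof (induction \<phi> arbitrary: \<nu> \<nu>')
  case (Geq a b)
  then have "trm_val a \<nu> = trm_val a \<nu>'" "trm_val b \<nu> = trm_val b \<nu>'"
    by (auto intro!: trm_val_cong)
  then show ?case by simp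
next
  case (Neg \<phi>)
  show ?case using Neg.IH[of \<nu> \<nu>'] Neg.prems by simp
next
  case (Conj \<phi> \<psi>)
  show ?case using Conj.IH(1)[of \<nu> \<nu>'] Conj.IH(2)[of \<nu> \<nu>'] Conj.prems by simp
next
  case (Exi v \<phi>)
  have "fol_true \<phi> (fun_upd \<nu> v r) = fol_true \<phi> (fun_upd \<nu>' v r)" for r
    using Exi.prems by (intro Exi.IH) auto
  then show ?case by simp
qed

lemma fol_true_Exists_vec:
  "fol_true (Exists_vec vs \<phi>) \<omega> \<longleftrightarrow> (\<exists>p. fol_true \<phi> (override_on \<omega> p (set vs)))"
proof (induction vs arbitrary: \<omega>)
  case Nil
  then show ?case by (simp add: Exists_vec_def)
next
  case (Cons v vs)
  \<comment> \<open>If \<open>v\<close> occurs again in \<open>vs\<close>, the inner quantifier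
    wins; therefore \<open>p\<close> takes precedence over \<open>r\<close>.\<close>
  have upd: "override_on (fun_upd \<omega> v r) p (set vs) =
      override_on \<omega> (\<lambda>w. if w \<in> set vs then p w else r) (set (v # vs))" for r p
    by (auto simp: override_on_def fun_eq_iff)
  have upd': "override_on \<omega> p (set (v # vs)) = override_on (fun_upd \<omega> v (p v)) p (set vs)" for p
    by (auto simp: override_on_def fun_eq_iff)
  have "fol_true (Exists_vec (v # vs) \<phi>) \<omega> \<longleftrightarrow>
      (\<exists>r p. fol_true \<phi> (override_on (fun_upd \<omega> v r) p (set vs)))"
    using Cons.IH by (simp add: Exists_vec_def fun_upd_def)
  also have "\<dots> \<longleftrightarrow> (\<exists>p. fol_true \<phi> (override_on \<omega> p (set (v # vs))))" (is "?l \<longleftrightarrow> ?r")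
  proof
    show ?r if ?l using that unfolding upd by blast
    show ?l if ?r using that unfolding upd' by blast
  qed
  finally show ?case .
qed

lemma fol_true_Forall_vec:
  "fol_true (Forall_vec vs \<phi>) \<omega> \<longleftrightarrow> (\<forall>p. fol_true \<phi> (override_on \<omega> p (set vs)))"
proof -
  have "fol_true (Forall_vec vs \<phi>) \<omega> \<longleftrightarrow> \<not> fol_true (Exists_vec vs (Neg \<phi>)) \<omega>" for \<omega>
    by (induction vs arbitrary: \<omega>) (simp_all add: Forall_vec_def Exists_vec_def)
  then show ?thesis by (simp add: fol_true_Exists_vec)
qed

section \<open>Polynomial terms on boxes\<close>

lemma trm_val_bounded:
  "\<exists>B. \<forall>\<nu>. (\<forall>v\<in>set_trm \<theta>. \<bar>\<nu> v\<bar> \<le> R) \<longrightarrow> \<bar>trm_val \<theta> \<nu>\<bar> \<le> B"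
proof (induction \<theta>)
  case (Const r)
  show ?case by (intro exI[of _ "\<bar>r\<bar>"]) simp
next
  case (Var v)
  show ?case by (intro exI[of _ R]) simp
next
  case (Plus a b)
  then obtain A B where "\<And>\<nu>. (\<forall>v\<in>set_trm a. \<bar>\<nu> v\<bar> \<le> R) \<Longrightarrow> \<bar>trm_val a \<nu>\<bar> \<le> A"
    "\<And>\<nu>. (\<forall>v\<in>set_trm b. \<bar>\<nu> v\<bar> \<le> R) \<Longrightarrow> \<bar>trm_val b \<nu>\<bar> \<le> B" by blast
  then have "\<bar>trm_val a \<nu> + trm_val b \<nu>\<bar> \<le> A + B"
    if "\<forall>v\<in>set_trm (Plus a b). \<bar>\<nu> v\<bar> \<le> R" for \<nu>
    using that by (intro order_trans[OF abs_triangle_ineq] add_mono) simp_all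
  then show ?case by (intro exI[of _ "A + B"]) simp
next
  case (Times a b)
  then obtain A B where AB: "\<And>\<nu>. (\<forall>v\<in>set_trm a. \<bar>\<nu> v\<bar> \<le> R) \<Longrightarrow> \<bar>trm_val a \<nu>\<bar> \<le> A"
    "\<And>\<nu>. (\<forall>v\<in>set_trm b. \<bar>\<nu> v\<bar> \<le> R) \<Longrightarrow> \<bar>trm_val b \<nu>\<bar> \<le> B" by blast
  have "\<bar>trm_val a \<nu> * trm_val b \<nu>\<bar> \<le> A * B"
    if \<nu>: "\<forall>v\<in>set_trm (Times a b). \<bar>\<nu> v\<bar> \<le> R" for \<nu>
  proof -
    have "\<bar>trm_val a \<nu>\<bar> \<le> A" "\<bar>trm_val b \<nu>\<bar> \<le> B" using AB \<nu> by simp_all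
    then show ?thesis unfolding abs_mult by (intro mult_mono) linarith+
  qed
  then show ?case by (intro exI[of _ "A * B"]) simp
qed

text \<open>Products need the box: each factor's increment is multiplied by a bound on the other
  factor. No sign is claimed for \<open>L\<close>, hence the absolute values where it is
  used.\<close>

lemma trm_val_lipschitz_on_box:
  "\<exists>L. \<forall>\<nu> \<nu>' d. d \<ge> 0 \<longrightarrow> (\<forall>v\<in>set_trm \<theta>. \<bar>\<nu> v\<bar> \<le> R \<and> \<bar>\<nu>' v\<bar> \<le> R \<and> \<bar>\<nu> v - \<nu>' v\<bar> \<le> d) \<longrightarrow>
     \<bar>trm_val \<theta> \<nu> - trm_val \<theta> \<nu>'\<bar> \<le> L * d"
proof (induction \<theta>)
  case (Const r)
  show ?case by (intro exI[of _ 0]) simp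
next
  case (Var v)
  show ?case by (intro exI[of _ 1]) simp
next
  case (Plus a b)
  then obtain A B where AB:
    "\<And>\<nu> \<nu>' d. d \<ge> 0 \<Longrightarrow> (\<forall>v\<in>set_trm a. \<bar>\<nu> v\<bar> \<le> R \<and> \<bar>\<nu>' v\<bar> \<le> R \<and> \<bar>\<nu> v - \<nu>' v\<bar> \<le> d) \<Longrightarrow>
       \<bar>trm_val a \<nu> - trm_val a \<nu>'\<bar> \<le> A * d"
    "\<And>\<nu> \<nu>' d. d \<ge> 0 \<Longrightarrow> (\<forall>v\<in>set_trm b. \<bar>\<nu> v\<bar> \<le> R \<and> \<bar>\<nu>' v\<bar> \<le> R \<and> \<bar>\<nu> v - \<nu>' v\<bar> \<le> d) \<Longrightarrow>
       \<bar>trm_val b \<nu> - trm_val b \<nu>'\<bar> \<le> B * d" by blast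
  show ?case
  proof (intro exI[of _ "A + B"] allI impI)
    fix \<nu> \<nu>' :: "'a state" and d :: real
    assume d: "d \<ge> 0"
      "\<forall>v\<in>set_trm (Plus a b). \<bar>\<nu> v\<bar> \<le> R \<and> \<bar>\<nu>' v\<bar> \<le> R \<and> \<bar>\<nu> v - \<nu>' v\<bar> \<le> d"
    have "\<bar>trm_val a \<nu> - trm_val a \<nu>'\<bar> \<le> A * d" "\<bar>trm_val b \<nu> - trm_val b \<nu>'\<bar> \<le> B * d"
      using d by (simp_all add: AB)
    then show "\<bar>trm_val (Plus a b) \<nu> - trm_val (Plus a b) \<nu>'\<bar> \<le> (A + B) * d"
      unfolding trm_val.simps distrib_right by linarith
  qed
next
  case (Times a b)
  then obtain A B where AB:
    "\<And>\<nu> \<nu>' d. d \<ge> 0 \<Longrightarrow> (\<forall>v\<in>set_trm a. \<bar>\<nu> v\<bar> \<le> R \<and> \<bar>\<nu>' v\<bar> \<le> R \<and> \<bar>\<nu> v - \<nu>' v\<bar> \<le> d) \<Longrightarrow>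
       \<bar>trm_val a \<nu> - trm_val a \<nu>'\<bar> \<le> A * d"
    "\<And>\<nu> \<nu>' d. d \<ge> 0 \<Longrightarrow> (\<forall>v\<in>set_trm b. \<bar>\<nu> v\<bar> \<le> R \<and> \<bar>\<nu>' v\<bar> \<le> R \<and> \<bar>\<nu> v - \<nu>' v\<bar> \<le> d) \<Longrightarrow>
       \<bar>trm_val b \<nu> - trm_val b \<nu>'\<bar> \<le> B * d" by blast
  obtain CA where CA: "\<And>\<nu>. (\<forall>v\<in>set_trm a. \<bar>\<nu> v\<bar> \<le> R) \<Longrightarrow> \<bar>trm_val a \<nu>\<bar> \<le> CA"
    using trm_val_bounded by blast
  obtain CB where CB: "\<And>\<nu>. (\<forall>v\<in>set_trm b. \<bar>\<nu> v\<bar> \<le> R) \<Longrightarrow> \<bar>trm_val b \<nu>\<bar> \<le> CB"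
    using trm_val_bounded by blast
  show ?case
  proof (intro exI[of _ "CA * B + CB * A"] allI impI)
    fix \<nu> \<nu>' :: "'a state" and d :: real
    assume d: "d \<ge> 0"
      "\<forall>v\<in>set_trm (Times a b). \<bar>\<nu> v\<bar> \<le> R \<and> \<bar>\<nu>' v\<bar> \<le> R \<and> \<bar>\<nu> v - \<nu>' v\<bar> \<le> d"
    have 1: "\<bar>trm_val a \<nu> - trm_val a \<nu>'\<bar> \<le> A * d" "\<bar>trm_val b \<nu> - trm_val b \<nu>'\<bar> \<le> B * d"
      using d by (simp_all add: AB)
    have 2: "\<bar>trm_val a \<nu>\<bar> \<le> CA" "\<bar>trm_val b \<nu>'\<bar> \<le> CB"
      using d by (simp_all add: CA CB)
    have "trm_val (Times a b) \<nu> - trm_val (Times a b) \<nu>' =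
        trm_val a \<nu> * (trm_val b \<nu> - trm_val b \<nu>') + trm_val b \<nu>' * (trm_val a \<nu> - trm_val a \<nu>')"
      by (simp add: algebra_simps)
    also have "\<bar>\<dots>\<bar> \<le> \<bar>trm_val a \<nu>\<bar> * \<bar>trm_val b \<nu> - trm_val b \<nu>'\<bar>
        + \<bar>trm_val b \<nu>'\<bar> * \<bar>trm_val a \<nu> - trm_val a \<nu>'\<bar>"
      by (rule order_trans[OF abs_triangle_ineq]) (simp add: abs_mult)
    also have "\<dots> \<le> CA * (B * d) + CB * (A * d)"
      using 1 2 by (intro add_mono mult_mono) linarith+
    finally show "\<bar>trm_val (Times a b) \<nu> - trm_val (Times a b) \<nu>'\<bar> \<le> (CA * B + CB * A) * d"
      by (simp add: algebra_simps)
  qed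
qed

lemma trm_val_measurable:
  "(\<And>v. v \<in> set_trm \<theta> \<Longrightarrow> (\<lambda>s. \<sigma> s v) \<in> borel_measurable N) \<Longrightarrow>
   (\<lambda>s. trm_val \<theta> (\<sigma> s)) \<in> borel_measurable N"
  by (induction \<theta>) auto

section \<open>The syntactic derivation and its meaning\<close>

lemma trm_val_map_trm: "trm_val (map_trm h \<theta>) \<nu> = trm_val \<theta> (\<lambda>v. \<nu> (h v))"
  by (induction \<theta>) auto

text \<open>Soundness of \<open>derivation\<close> by the sum and product rules, with
  \<open>Base v\<close> read as the current value of \<open>v\<close> and \<open>Prime v\<close> as
  its velocity.\<close>

lemma trm_val_has_derivative:
  assumes "\<And>v. v \<in> set_trm g \<Longrightarrow> ((\<lambda>t. \<sigma> t v) has_real_derivative \<sigma>' v) (at s within S)"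
  shows "((\<lambda>t. trm_val g (\<sigma> t)) has_real_derivative
    trm_val (derivation g) (case_sym (\<sigma> s) \<sigma>')) (at s within S)"
  using assms
  by (induction g) (auto simp: trm_val_map_trm intro!: derivative_eq_intros)

lemma trm_val_subst_diff:
  "trm_val (subst_diff xs \<theta>s D) \<nu> = trm_val D (\<lambda>w. trm_val (subst_sym xs \<theta>s w) \<nu>)"
  by (induction D) auto

lemma set_trm_derivation: "set_trm (derivation g) \<subseteq> Base ` set_trm g \<union> Prime ` set_trm g"
  by (induction g) (auto simp: trm.set_map)

lemma set_trm_subst_diff:
  "set_trm (subst_diff xs \<theta>s D) \<subseteq> (\<Union>w\<in>set_trm D. set_trm (subst_sym xs \<theta>s w))"
  by (induction D) auto

text \<open>Serves to show that the fresh variable \<open>e\<close> does not occur in the Lie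
  derivative of \<open>g\<close>.\<close>

lemma set_trm_subst_derivation:
  "set_trm (subst_diff xs \<theta>s (derivation g)) \<subseteq> set_trm g \<union> (\<Union>\<theta>\<in>set \<theta>s. set_trm \<theta>)"
proof -
  have "set_trm (subst_sym xs \<theta>s w) \<subseteq> set_trm g \<union> (\<Union>\<theta>\<in>set \<theta>s. set_trm \<theta>)"
    if "w \<in> set_trm (derivation g)" for w
  proof (cases w)
    case (Base v)
    then show ?thesis using that set_trm_derivation[of g] by auto
  next
    case (Prime v)
    then show ?thesis by (auto split: option.splits dest!: map_of_SomeD set_zip_rightD)
  qed
  then show ?thesis using set_trm_subst_diff[of xs \<theta>s "derivation g"] by blast
qed

text \<open>Projections are continuous, so each coordinate has compact, hence bounded, range;
  summing the finitely many bounds makes them uniform.\<close>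

lemma compactin_defined_set_bounded:
  assumes "compactin (powertop_real (set vs)) (defined_set vs \<phi>)"
  obtains B where "\<And>p v. p \<in> defined_set vs \<phi> \<Longrightarrow> v \<in> set vs \<Longrightarrow> \<bar>p v\<bar> \<le> B"
proof -
  have "\<forall>v\<in>set vs. \<exists>B. \<forall>p\<in>defined_set vs \<phi>. \<bar>p v\<bar> \<le> B"
  proof
    fix v assume "v \<in> set vs"
    then have "compactin euclideanreal ((\<lambda>p. p v) ` defined_set vs \<phi>)"
      by (intro image_compactin[OF assms] continuous_map_product_projection)
    then have "bounded ((\<lambda>p. p v) ` defined_set vs \<phi>)"
      by (simp add: compact_imp_bounded)
    then show "\<exists>B. \<forall>p\<in>defined_set vs \<phi>. \<bar>p v\<bar> \<le> B"
      by (auto simp: bounded_iff)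
  qed
  then obtain B where B: "\<forall>v\<in>set vs. \<forall>p\<in>defined_set vs \<phi>. \<bar>p v\<bar> \<le> B v"
    by (rule bchoice[THEN exE])
  show ?thesis
  proof
    fix p v assume "p \<in> defined_set vs \<phi>" "v \<in> set vs"
    then have "\<bar>p v\<bar> \<le> \<bar>B v\<bar>" using B by fastforce
    also have "\<dots> \<le> (\<Sum>v\<in>set vs. \<bar>B v\<bar>)"
      using \<open>v \<in> set vs\<close> by (intro member_le_sum) auto
    finally show "\<bar>p v\<bar> \<le> (\<Sum>v\<in>set vs. \<bar>B v\<bar>)" .
  qed
qed

section \<open>Trajectories of the control system\<close>

text \<open>\<open>rhs_bound\<close> leaves the \<open>xs\<close> coordinates free. This rules out
  escape in finite time and gives an a priori box for any horizon.\<close>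

locale control_system =
  fixes xs ys zs :: "'v list" and fs :: "'v trm list" and Y Z :: "'v fol" and M B :: real
  assumes dist: "distinct (xs @ ys @ zs)" and len: "length fs = length xs"
    and vars: "\<And>\<theta>. \<theta> \<in> set fs \<Longrightarrow> set_trm \<theta> \<subseteq> set xs \<union> set ys \<union> set zs"
    and M: "0 \<le> M"
    and rhs_bound: "\<And>\<theta> \<nu>. \<theta> \<in> set fs \<Longrightarrow> restrict \<nu> (set ys) \<in> defined_set ys Y \<Longrightarrow>
      restrict \<nu> (set zs) \<in> defined_set zs Z \<Longrightarrow> \<bar>trm_val \<theta> \<nu>\<bar> \<le> M"
    and Y_bound: "\<And>p v. p \<in> defined_set ys Y \<Longrightarrow> v \<in> set ys \<Longrightarrow> \<bar>p v\<bar> \<le> B"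
    and Z_bound: "\<And>p v. p \<in> defined_set zs Z \<Longrightarrow> v \<in> set zs \<Longrightarrow> \<bar>p v\<bar> \<le> B"
begin

text \<open>The nesting is that of \<open>caratheodory_solution\<close>, so unfolding identifies the
  two. The order is immaterial for disjoint vectors.\<close>

definition combined :: "'v state \<Rightarrow> ('v \<Rightarrow> real) \<Rightarrow> ('v \<Rightarrow> real) \<Rightarrow> ('v \<Rightarrow> real) \<Rightarrow> 'v state" where
  "combined \<omega> x y z = override_on (override_on (override_on \<omega> x (set xs)) y (set ys)) z (set zs)"

text \<open>Indexed by variable instead of position, to fit \<open>bounded_lipschitz_ivp\<close>,
  whose coordinates are the elements of a set.\<close>

definition rhs :: "'v state \<Rightarrow> (real \<Rightarrow> 'v \<Rightarrow> real) \<Rightarrow> (real \<Rightarrow> 'v \<Rightarrow> real) \<Rightarrow> 'v \<Rightarrow> real \<Rightarrow> ('v \<Rightarrow> real) \<Rightarrow> real"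
  where "rhs \<omega> y z v s x = trm_val (the (map_of (zip xs fs) v)) (combined \<omega> x (y s) (z s))"

abbreviation traj where
  "traj T \<omega> y z \<equiv> THE X. caratheodory_solution T xs fs ys y zs z \<omega> X"

lemma disjoint:
  "v \<in> set xs \<Longrightarrow> v \<notin> set ys" "v \<in> set xs \<Longrightarrow> v \<notin> set zs" "v \<in> set ys \<Longrightarrow> v \<notin> set zs"
  using dist by auto

lemma combined_simps:
  "v \<in> set xs \<Longrightarrow> combined \<omega> x y z v = x v"
  "v \<in> set ys \<Longrightarrow> combined \<omega> x y z v = y v"
  "v \<in> set zs \<Longrightarrow> combined \<omega> x y z v = z v"
  "v \<notin> set xs \<Longrightarrow> v \<notin> set ys \<Longrightarrow> v \<notin> set zs \<Longrightarrow> combined \<omega> x y z v = \<omega> v"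
  by (simp_all add: combined_def override_on_def disjoint)

lemma combined_cong:
  assumes "\<And>v. v \<in> set xs \<Longrightarrow> x v = x' v"
  shows "combined \<omega> x y z = combined \<omega> x' y z"
  using assms by (auto simp: combined_def override_on_def fun_eq_iff)

lemma map_of_rhs:
  "i < length xs \<Longrightarrow> map_of (zip xs fs) (xs ! i) = Some (fs ! i)"
  by (rule map_of_zip_nth) (use dist len in simp_all)

lemma rhs_nth:
  "i < length xs \<Longrightarrow> rhs \<omega> y z (xs ! i) s x = trm_val (fs ! i) (combined \<omega> x (y s) (z s))"
  by (simp add: rhs_def map_of_rhs)

lemma rhs_term_in:
  assumes "v \<in> set xs"
  shows "the (map_of (zip xs fs) v) \<in> set fs"
proof -
  obtain i where "i < length xs" "v = xs ! i" using assms by (auto simp: in_set_conv_nth)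
  then show ?thesis using len by (simp add: map_of_rhs)
qed

lemma rhs_cong:
  assumes "\<And>v. v \<in> set xs \<Longrightarrow> x v = x' v"
  shows "rhs \<omega> y z v s x = rhs \<omega> y z v s x'"
  using combined_cong[OF assms] by (simp add: rhs_def)

lemma abs_rhs_le:
  assumes y: "y s \<in> defined_set ys Y" and z: "z s \<in> defined_set zs Z" and "v \<in> set xs"
  shows "\<bar>rhs \<omega> y z v s x\<bar> \<le> M"
  unfolding rhs_def
proof (rule rhs_bound[OF rhs_term_in[OF assms(3)]])
  have "y s \<in> extensional (set ys)" "z s \<in> extensional (set zs)"
    using y z by (simp_all add: defined_set_def PiE_def)
  then have "restrict (combined \<omega> x (y s) (z s)) (set ys) = y s"
    "restrict (combined \<omega> x (y s) (z s)) (set zs) = z s"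
    by (simp_all add: extensional_def fun_eq_iff combined_simps)
  then show "restrict (combined \<omega> x (y s) (z s)) (set ys) \<in> defined_set ys Y"
    "restrict (combined \<omega> x (y s) (z s)) (set zs) \<in> defined_set zs Z"
    using y z by simp_all
qed

lemma controls_in: "u \<in> controls T vs \<phi> \<Longrightarrow> s \<in> {0..T} \<Longrightarrow> u s \<in> defined_set vs \<phi>"
  unfolding controls_def by (blast dest: PiE_mem)

lemma controls_component_measurable:
  assumes "u \<in> controls T vs \<phi>" "v \<in> set vs" "\<tau> \<le> T"
  shows "(\<lambda>s. u s v) \<in> borel_measurable (lebesgue_on {0..\<tau>})"
proof -
  have "u \<in> lebesgue_on {0..T} \<rightarrow>\<^sub>M PiM (set vs) (\<lambda>_. borel)"
    using assms by (simp add: controls_def)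
  then have "(\<lambda>s. u s v) \<in> borel_measurable (lebesgue_on {0..T})"
    using measurable_component_singleton[OF assms(2)] by (rule measurable_compose)
  then show ?thesis by (rule measurable_restrict_mono) (use assms(3) in simp)
qed

text \<open>The radius \<open>R\<close> adds up the initial state, the drift possible up to
  \<open>\<tau>\<close> and the size of the controls. The horizon \<open>\<tau>\<close> may be
  shorter than \<open>T\<close>, so that initial segments of trajectories can be compared.\<close>

lemma ivp:
  assumes "0 \<le> \<tau>" "\<tau> \<le> T" and y: "y \<in> controls T ys Y" and z: "z \<in> controls T zs Z"
  shows "\<exists>L. bounded_lipschitz_ivp (set xs) \<tau> M L \<omega> (rhs \<omega> y z)"
proof -
  define R where "R = (\<Sum>v\<in>set xs. \<bar>\<omega> v\<bar>) + M * \<tau> + \<bar>B\<bar>"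
  have "\<forall>\<theta>\<in>set fs. \<exists>L. \<forall>\<nu> \<nu>' d. d \<ge> 0 \<longrightarrow>
      (\<forall>v\<in>set_trm \<theta>. \<bar>\<nu> v\<bar> \<le> R \<and> \<bar>\<nu>' v\<bar> \<le> R \<and> \<bar>\<nu> v - \<nu>' v\<bar> \<le> d) \<longrightarrow>
      \<bar>trm_val \<theta> \<nu> - trm_val \<theta> \<nu>'\<bar> \<le> L * d"
    by (intro ballI trm_val_lipschitz_on_box)
  then obtain l where l: "\<forall>\<theta>\<in>set fs. \<forall>\<nu> \<nu>' d. d \<ge> 0 \<longrightarrow>
      (\<forall>v\<in>set_trm \<theta>. \<bar>\<nu> v\<bar> \<le> R \<and> \<bar>\<nu>' v\<bar> \<le> R \<and> \<bar>\<nu> v - \<nu>' v\<bar> \<le> d) \<longrightarrow>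
      \<bar>trm_val \<theta> \<nu> - trm_val \<theta> \<nu>'\<bar> \<le> l \<theta> * d"
    by (rule bchoice[THEN exE])
  \<comment> \<open>The sum dominates the constant of each component; \<open>+ 1\<close> makes it
    positive even if \<open>fs\<close> is empty.\<close>
  define L where "L = (\<Sum>\<theta>\<in>set fs. \<bar>l \<theta>\<bar>) + 1"
  have lL: "l \<theta> \<le> L" if "\<theta> \<in> set fs" for \<theta>
  proof -
    have "\<bar>l \<theta>\<bar> \<le> (\<Sum>\<theta>\<in>set fs. \<bar>l \<theta>\<bar>)" using that by (intro member_le_sum) auto
    then show ?thesis by (simp add: L_def)
  qed
  have mem: "s \<in> {0..T}" if "s \<in> {0..\<tau>}" for s using that assms(2) by simp
  have xR: "\<bar>x v\<bar> \<le> R" if "v \<in> set xs" "\<bar>x v - \<omega> v\<bar> \<le> M * \<tau>" for x v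
  proof -
    have "\<bar>\<omega> v\<bar> \<le> (\<Sum>v\<in>set xs. \<bar>\<omega> v\<bar>)" using that(1) by (intro member_le_sum) auto
    then show ?thesis using that(2) unfolding R_def by linarith
  qed
  have BR: "\<bar>B\<bar> \<le> R" using M assms(1) by (simp add: R_def sum_nonneg)
  have "bounded_lipschitz_ivp (set xs) \<tau> M L \<omega> (rhs \<omega> y z)"
  proof
    show "0 \<le> \<tau>" "0 \<le> M" by fact+ (rule M)
    show "0 < L" unfolding L_def by (intro add_nonneg_pos sum_nonneg) auto
    show "\<bar>rhs \<omega> y z v s x\<bar> \<le> M" if "v \<in> set xs" "s \<in> {0..\<tau>}" for v s x
      by (rule abs_rhs_le[where y=y and z=z and s=s, OF controls_in[OF y mem[OF that(2)]] controls_in[OF z mem[OF that(2)]] that(1)])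
    show "\<bar>rhs \<omega> y z v s x - rhs \<omega> y z v s x'\<bar> \<le> L * d"
      if v: "v \<in> set xs" and s: "s \<in> {0..\<tau>}"
        and x: "\<And>w. w \<in> set xs \<Longrightarrow> \<bar>x w - \<omega> w\<bar> \<le> M * \<tau>"
        and x': "\<And>w. w \<in> set xs \<Longrightarrow> \<bar>x' w - \<omega> w\<bar> \<le> M * \<tau>"
        and d: "\<And>w. w \<in> set xs \<Longrightarrow> \<bar>x w - x' w\<bar> \<le> d" for v s x x' d
    proof -
      define \<theta> where "\<theta> = the (map_of (zip xs fs) v)"
      have \<theta>: "\<theta> \<in> set fs" unfolding \<theta>_def by (rule rhs_term_in[OF v])
      have d0: "d \<ge> 0" using d[OF v] by linarith
      let ?c = "combined \<omega> x (y s) (z s)" and ?c' = "combined \<omega> x' (y s) (z s)"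
      have "\<bar>?c w\<bar> \<le> R \<and> \<bar>?c' w\<bar> \<le> R \<and> \<bar>?c w - ?c' w\<bar> \<le> d" if w: "w \<in> set_trm \<theta>" for w
      proof -
        consider "w \<in> set xs" | "w \<in> set ys" | "w \<in> set zs" using vars[OF \<theta>] w by blast
        then show ?thesis
        proof cases
          case 1
          then show ?thesis using xR[where x=x, OF 1 x[OF 1]] xR[where x=x', OF 1 x'[OF 1]] d[OF 1]
            by (simp add: combined_simps)
        next
          case 2
          have "\<bar>y s w\<bar> \<le> B" using Y_bound[OF controls_in[OF y mem[OF s]] 2] .
          then have "\<bar>y s w\<bar> \<le> R" using BR by linarith
          then show ?thesis using 2 d0 by (simp add: combined_simps)
        next
          case 3
          have "\<bar>z s w\<bar> \<le> B" using Z_bound[OF controls_in[OF z mem[OF s]] 3] .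
          then have "\<bar>z s w\<bar> \<le> R" using BR by linarith
          then show ?thesis using 3 d0 by (simp add: combined_simps)
        qed
      qed
      then have "\<bar>trm_val \<theta> ?c - trm_val \<theta> ?c'\<bar> \<le> l \<theta> * d"
        using l[rule_format, OF \<theta> d0] by blast
      also have "\<dots> \<le> L * d" using lL[OF \<theta>] d0 by (rule mult_right_mono)
      finally show ?thesis unfolding rhs_def \<theta>_def .
    qed
    show "(\<lambda>s. rhs \<omega> y z v s (X s)) \<in> borel_measurable (lebesgue_on {0..\<tau>})"
      if v: "v \<in> set xs" and X: "\<And>w. w \<in> set xs \<Longrightarrow> continuous_on {0..\<tau>} (\<lambda>s. X s w)" for v X
      unfolding rhs_def
    proof (rule trm_val_measurable)
      fix w assume "w \<in> set_trm (the (map_of (zip xs fs) v))"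
      then consider "w \<in> set xs" | "w \<in> set ys" | "w \<in> set zs"
        using vars[OF rhs_term_in[OF v]] by blast
      then show "(\<lambda>s. combined \<omega> (X s) (y s) (z s) w) \<in> borel_measurable (lebesgue_on {0..\<tau>})"
      proof cases
        case 1
        have "(\<lambda>s. X s w) \<in> borel_measurable (lebesgue_on {0..\<tau>})"
          by (rule continuous_imp_measurable_on_sets_lebesgue[OF X[OF 1]]) simp
        then show ?thesis using 1 by (simp add: combined_simps)
      next
        case 2
        then show ?thesis using controls_component_measurable[OF y 2 assms(2)]
          by (simp add: combined_simps)
      next
        case 3
        then show ?thesis using controls_component_measurable[OF z 3 assms(2)]
          by (simp add: combined_simps)
      qed
    qed
  qed
  then show ?thesis by blast
qed

text \<open>Integrals do not see null sets, so the equation may be written with any controls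
  \<open>y'\<close>, \<open>z'\<close> that agree almost everywhere. This places trajectories of
  different controls in one and the same initial value problem.\<close>

lemma caratheodory_imp_integral_equation:
  assumes X: "caratheodory_solution T xs fs ys y zs z \<omega> X" and \<tau>: "0 \<le> \<tau>" "\<tau> \<le> T"
    and y: "AE t in lebesgue_on {0..\<tau>}. y t = y' t" and z: "AE t in lebesgue_on {0..\<tau>}. z t = z' t"
    and v: "v \<in> set xs" and t: "t \<in> {0..\<tau>}"
  shows "X t v = \<omega> v + integral {0..t} (\<lambda>s. rhs \<omega> y' z' v s (X s))"
proof -
  obtain i where i: "i < length xs" "v = xs ! i" using v by (auto simp: in_set_conv_nth)
  define N1 where "N1 = {s \<in> {0..T}. \<not> (\<forall>i<length xs.
      ((\<lambda>t. X t (xs ! i)) has_real_derivative trm_val (fs ! i) (combined \<omega> (X s) (y s) (z s)))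
        (at s within {0..T}))}"
  define N2 where "N2 = {s \<in> {0..\<tau>}. y s \<noteq> y' s}"
  define N3 where "N3 = {s \<in> {0..\<tau>}. z s \<noteq> z' s}"
  have "AE s in lebesgue_on {0..T}. \<forall>i<length xs.
      ((\<lambda>t. X t (xs ! i)) has_real_derivative trm_val (fs ! i) (combined \<omega> (X s) (y s) (z s)))
        (at s within {0..T})"
    using X unfolding caratheodory_solution_def combined_def by blast
  then have N: "negligible (N1 \<union> N2 \<union> N3)"
    using y z by (simp add: N1_def N2_def N3_def AE_lebesgue_on_iff_negligible)
  have AC: "abs_continuous_on {0..t} (\<lambda>s. X s v)"
  proof (rule abs_continuous_on_subset)
    show "abs_continuous_on {0..T} (\<lambda>s. X s v)" using X v by (simp add: caratheodory_solution_def)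
  qed (use t \<tau> in auto)
  have der: "((\<lambda>t. X t v) has_real_derivative rhs \<omega> y' z' v s (X s)) (at s within {0..t})"
    if s: "s \<in> {0..t} - (N1 \<union> N2 \<union> N3)" for s
  proof -
    have "s \<in> {0..T}" "s \<in> {0..\<tau>}" using s t \<tau> by auto
    then have "((\<lambda>t. X t v) has_real_derivative trm_val (fs ! i) (combined \<omega> (X s) (y s) (z s)))
        (at s within {0..T})" and eq: "y s = y' s" "z s = z' s"
      using s i by (auto simp: N1_def N2_def N3_def)
    then have "((\<lambda>t. X t v) has_real_derivative rhs \<omega> y' z' v s (X s)) (at s within {0..T})"
      by (simp add: i(2) rhs_nth[OF i(1)])
    then show ?thesis by (rule DERIV_subset) (use t \<tau> in auto)
  qed
  have "((\<lambda>s. rhs \<omega> y' z' v s (X s)) has_integral X t v - X 0 v) {0..t}"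
    by (rule abs_continuous_has_integral[OF _ AC N der]) (use t in auto)
  moreover have "X 0 v = \<omega> v" using X v by (simp add: caratheodory_solution_def)
  ultimately show ?thesis by (simp add: integral_unique)
qed

lemma caratheodory_continuous_on:
  assumes "caratheodory_solution T xs fs ys y zs z \<omega> X" "v \<in> set xs" "\<tau> \<le> T"
  shows "continuous_on {0..\<tau>} (\<lambda>s. X s v)"
proof -
  have "continuous_on {0..T} (\<lambda>s. X s v)"
    using assms by (intro abs_continuous_on_imp_continuous_on) (simp add: caratheodory_solution_def)
  then show ?thesis by (rule continuous_on_subset) (use assms(3) in simp)
qed

text \<open>Both functions solve the integral equation of the primed controls on
  \<open>{0..\<tau>}\<close>. Equal controls with \<open>\<tau> = T\<close> give uniqueness, a
  smaller \<open>\<tau>\<close> gives causality.\<close>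

lemma caratheodory_unique:
  assumes X: "caratheodory_solution T xs fs ys y zs z \<omega> X"
    and X': "caratheodory_solution T xs fs ys y' zs z' \<omega> X'"
    and y': "y' \<in> controls T ys Y" and z': "z' \<in> controls T zs Z" and \<tau>: "0 \<le> \<tau>" "\<tau> \<le> T"
    and y: "AE t in lebesgue_on {0..\<tau>}. y t = y' t" and z: "AE t in lebesgue_on {0..\<tau>}. z t = z' t"
    and v: "v \<in> set xs" and t: "t \<in> {0..\<tau>}"
  shows "X t v = X' t v"
proof -
  obtain L where "bounded_lipschitz_ivp (set xs) \<tau> M L \<omega> (rhs \<omega> y' z')"
    using ivp[OF \<tau> y' z'] by (rule exE)
  then interpret bounded_lipschitz_ivp "set xs" \<tau> M L \<omega> "rhs \<omega> y' z'" .
  have "solution X" unfolding solution_def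
    by (intro conjI ballI caratheodory_continuous_on[OF X _ \<tau>(2)]
        caratheodory_imp_integral_equation[OF X \<tau> y z])
  moreover have "solution X'" unfolding solution_def
    by (intro conjI ballI caratheodory_continuous_on[OF X' _ \<tau>(2)]
        caratheodory_imp_integral_equation[OF X' \<tau>]) simp_all
  ultimately show ?thesis using v t by (rule solution_unique)
qed

lemma caratheodory_exists:
  assumes T: "0 \<le> T" and y: "y \<in> controls T ys Y" and z: "z \<in> controls T zs Z"
  shows "\<exists>X. caratheodory_solution T xs fs ys y zs z \<omega> X"
proof -
  obtain L where "bounded_lipschitz_ivp (set xs) T M L \<omega> (rhs \<omega> y z)"
    using ivp[OF T order_refl y z] by (rule exE)
  then interpret bounded_lipschitz_ivp "set xs" T M L \<omega> "rhs \<omega> y z" .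
  obtain W where W: "solution W" using solution_exists by blast
  \<comment> \<open>Restriction in both arguments makes the solution extensional, as
    \<open>caratheodory_solution\<close> demands.\<close>
  define X where "X = (\<lambda>s\<in>{0..T}. restrict (W s) (set xs))"
  have XW: "X s v = W s v" if "s \<in> {0..T}" "v \<in> set xs" for s v
    using that by (simp add: X_def)
  have rhsW: "rhs \<omega> y z v s (X s) = rhs \<omega> y z v s (W s)" if "s \<in> {0..T}" for v s
    by (rule rhs_cong) (rule XW[OF that])
  \<comment> \<open>Each coordinate has its own exceptional null set; their finite union serves for
    all coordinates at once.\<close>
  have "\<forall>v\<in>set xs. \<exists>N. negligible N \<and> (\<forall>s\<in>{0..T} - N.
      ((\<lambda>t. integral {0..t} (\<lambda>s. rhs \<omega> y z v s (W s))) has_real_derivative rhs \<omega> y z v s (W s))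
        (at s within {0..T}))"
  proof
    fix v assume "v \<in> set xs"
    then have "(\<lambda>s. rhs \<omega> y z v s (W s)) integrable_on {0..T}"
      using W T by (intro rhs_integrable) (simp_all add: solution_def)
    then show "\<exists>N. negligible N \<and> (\<forall>s\<in>{0..T} - N.
      ((\<lambda>t. integral {0..t} (\<lambda>s. rhs \<omega> y z v s (W s))) has_real_derivative rhs \<omega> y z v s (W s))
        (at s within {0..T}))"
      by (rule integral_AE_has_derivative) (intro exI conjI ballI)
  qed
  then obtain N where N: "\<forall>v\<in>set xs. negligible (N v) \<and> (\<forall>s\<in>{0..T} - N v.
      ((\<lambda>t. integral {0..t} (\<lambda>s. rhs \<omega> y z v s (W s))) has_real_derivative rhs \<omega> y z v s (W s))
        (at s within {0..T}))"
    by (rule bchoice[THEN exE])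
  have null: "negligible (\<Union>v\<in>set xs. N v)" using N by (intro negligible_Union) auto
  have der: "((\<lambda>t. X t (xs ! i)) has_real_derivative trm_val (fs ! i) (combined \<omega> (X s) (y s) (z s)))
        (at s within {0..T})"
    if s: "s \<in> {0..T}" "s \<notin> (\<Union>v\<in>set xs. N v)" and i: "i < length xs" for s i
  proof -
    have xi: "xs ! i \<in> set xs" using i by simp
    have "s \<in> {0..T} - N (xs ! i)" using s xi by blast
    then have "((\<lambda>t. integral {0..t} (\<lambda>s. rhs \<omega> y z (xs ! i) s (W s))) has_real_derivative
        rhs \<omega> y z (xs ! i) s (W s)) (at s within {0..T})"
      using N xi by blast
    from DERIV_add[OF DERIV_const[of "\<omega> (xs ! i)"] this]
    have "((\<lambda>t. \<omega> (xs ! i) + integral {0..t} (\<lambda>s. rhs \<omega> y z (xs ! i) s (W s))) has_real_derivative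
        trm_val (fs ! i) (combined \<omega> (X s) (y s) (z s))) (at s within {0..T})"
      by (simp add: rhs_nth[OF i] rhsW[OF s(1), of "xs ! i", unfolded rhs_nth[OF i]])
    then show ?thesis
    proof (rule has_field_derivative_transform_within[where d = 1])
      show "\<omega> (xs ! i) + integral {0..t} (\<lambda>s. rhs \<omega> y z (xs ! i) s (W s)) = X t (xs ! i)"
        if "t \<in> {0..T}" for t
        using W that xi by (simp add: XW solution_def)
    qed (use s in auto)
  qed
  have "caratheodory_solution T xs fs ys y zs z \<omega> X"
    unfolding caratheodory_solution_def
  proof (intro conjI ballI)
    show "X \<in> {0..T} \<rightarrow>\<^sub>E (set xs \<rightarrow>\<^sub>E UNIV)" by (simp add: X_def)
    show "X 0 v = \<omega> v" if "v \<in> set xs" for v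
      using that T W XW[of 0 v] by (simp add: solution_def)
    show "abs_continuous_on {0..T} (\<lambda>s. X s v)" if "v \<in> set xs" for v
      using solution_lipschitz[OF W that] XW[OF _ that] by (intro lipschitz_imp_abs_continuous_on[OF M]) simp
    have "negligible {s \<in> {0..T}. \<not> (\<forall>i<length xs.
      ((\<lambda>t. X t (xs ! i)) has_real_derivative trm_val (fs ! i) (combined \<omega> (X s) (y s) (z s)))
        (at s within {0..T}))}"
      by (rule negligible_subset[OF null]) (use der in blast)
    then show "AE s in lebesgue_on {0..T}. \<forall>i<length xs.
        ((\<lambda>t. X t (xs ! i)) has_real_derivative
          trm_val (fs ! i)
            (override_on (override_on (override_on \<omega> (X s) (set xs)) (y s) (set ys)) (z s) (set zs)))
        (at s within {0..T})"
      by (simp add: AE_lebesgue_on_iff_negligible combined_def)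
  qed
  then show ?thesis by blast
qed

text \<open>Gives the \<open>THE\<close> in \<open>response\<close> its meaning. Extensionality
  upgrades agreement on \<open>{0..T}\<close> and \<open>set xs\<close> to equality of
  functions.\<close>

lemma traj_caratheodory:
  assumes T: "0 \<le> T" and y: "y \<in> controls T ys Y" and z: "z \<in> controls T zs Z"
  shows "caratheodory_solution T xs fs ys y zs z \<omega> (traj T \<omega> y z)"
proof (rule theI'[where P = "caratheodory_solution T xs fs ys y zs z \<omega>"])
  show "\<exists>!X. caratheodory_solution T xs fs ys y zs z \<omega> X"
  proof (rule ex_ex1I[OF caratheodory_exists[OF assms]])
    fix X X' assume X: "caratheodory_solution T xs fs ys y zs z \<omega> X"
      and X': "caratheodory_solution T xs fs ys y zs z \<omega> X'"
    have PiE: "X \<in> {0..T} \<rightarrow>\<^sub>E (set xs \<rightarrow>\<^sub>E UNIV)" "X' \<in> {0..T} \<rightarrow>\<^sub>E (set xs \<rightarrow>\<^sub>E UNIV)"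
      using X X' by (simp_all add: caratheodory_solution_def)
    have "X t v = X' t v" if "t \<in> {0..T}" "v \<in> set xs" for t v
      using caratheodory_unique[OF X X' y z T order_refl] that by simp
    then have "X t = X' t" if "t \<in> {0..T}" for t
      using that PiE[THEN PiE_mem, OF that] by (intro extensionalityI[of _ "set xs"]) (auto simp: PiE_def)
    then show "X = X'"
      using PiE by (intro extensionalityI[of _ "{0..T}"]) (simp_all add: PiE_def)
  qed
qed

text \<open>Causality: what is observed at time \<open>\<tau>\<close> depends only on the controls
  up to \<open>\<tau>\<close>, and on these only up to null sets.\<close>

lemma traj_local:
  assumes \<tau>: "0 \<le> \<tau>" "\<tau> \<le> T" and y: "y \<in> controls T ys Y" and y': "y' \<in> controls T ys Y"
    and z: "z \<in> controls T zs Z" and z': "z' \<in> controls T zs Z"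
    and "AE t in lebesgue_on {0..\<tau>}. y t = y' t" "AE t in lebesgue_on {0..\<tau>}. z t = z' t"
    and "v \<in> set xs" "t \<in> {0..\<tau>}"
  shows "traj T \<omega> y z t v = traj T \<omega> y' z' t v"
proof -
  have T: "0 \<le> T" using \<tau> by linarith
  show ?thesis
    by (rule caratheodory_unique[OF traj_caratheodory[OF T y z] traj_caratheodory[OF T y' z'] y' z' \<tau>]) fact+
qed

context
  fixes T :: real and \<omega> :: "'v state" and y z :: "real \<Rightarrow> 'v \<Rightarrow> real"
  assumes T: "0 \<le> T" and y: "y \<in> controls T ys Y" and z: "z \<in> controls T zs Z"
begin

lemma traj_lipschitz:
  assumes "v \<in> set xs" "s \<in> {0..T}" "t \<in> {0..T}"
  shows "\<bar>traj T \<omega> y z s v - traj T \<omega> y z t v\<bar> \<le> M * \<bar>s - t\<bar>"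
proof -
  obtain L where "bounded_lipschitz_ivp (set xs) T M L \<omega> (rhs \<omega> y z)"
    using ivp[OF T order_refl y z] by (rule exE)
  then interpret bounded_lipschitz_ivp "set xs" T M L \<omega> "rhs \<omega> y z" .
  note c = traj_caratheodory[OF T y z, of \<omega>]
  have "solution (traj T \<omega> y z)" unfolding solution_def
    by (intro conjI ballI caratheodory_continuous_on[OF c _ order_refl]
        caratheodory_imp_integral_equation[OF c T order_refl]) simp_all
  then show ?thesis using assms by (rule solution_lipschitz)
qed

lemma traj_0: "v \<in> set xs \<Longrightarrow> traj T \<omega> y z 0 v = \<omega> v"
  using traj_caratheodory[OF T y z, of \<omega>] by (simp add: caratheodory_solution_def)

end

end

section \<open>Sample-and-hold strategies\<close>

lemma finite_set_trm: "finite (set_trm \<theta>)"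
  by (induction \<theta>) auto

lemma AE_lebesgue_on_subset:
  assumes "AE t in lebesgue_on S. P t" "R \<subseteq> S" "R \<in> sets lebesgue" "S \<in> sets lebesgue"
  shows "AE t in lebesgue_on R. P t"
proof -
  have "negligible {t \<in> S. \<not> P t}" using assms(1,4) by (simp add: AE_lebesgue_on_iff_negligible)
  then have "negligible {t \<in> R. \<not> P t}" by (rule negligible_subset) (use assms(2) in blast)
  then show ?thesis using assms(3) by (simp add: AE_lebesgue_on_iff_negligible)
qed

context control_system
begin

text \<open>The chain rule: the substituted syntactic derivative is the Lie derivative of
  \<open>g\<close> along the vector field \<open>fs\<close>.\<close>

lemma trm_derivative_along_solution:
  assumes X: "\<And>i. i < length xs \<Longrightarrow>
      ((\<lambda>t. X t (xs ! i)) has_real_derivative trm_val (fs ! i) (combined \<omega> (X s) y z)) (at s within S)"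
    and g: "set_trm g \<inter> (set ys \<union> set zs) = {}"
  shows "((\<lambda>t. trm_val g (override_on \<omega> (X t) (set xs))) has_real_derivative
      trm_val (subst_diff xs fs (derivation g)) (combined \<omega> (X s) y z)) (at s within S)"
proof -
  define c where "c = combined \<omega> (X s) y z"
  define \<sigma>' where "\<sigma>' = (\<lambda>v. trm_val (subst_sym xs fs (Prime v)) c)"
  have "((\<lambda>t. override_on \<omega> (X t) (set xs) v) has_real_derivative \<sigma>' v) (at s within S)" for v
  proof (cases "v \<in> set xs")
    case True
    then obtain i where "i < length xs" "v = xs ! i" by (auto simp: in_set_conv_nth)
    then show ?thesis using X[of i] by (simp add: \<sigma>'_def map_of_rhs c_def override_on_def)
  next
    \<comment> \<open>Coordinates outside \<open>xs\<close> stay at their value in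
      \<open>\<omega>\<close>; their velocity 0 is the default \<open>Const 0\<close> of
      \<open>subst_sym\<close>.\<close>
    case False
    then have "map_of (zip xs fs) v = None" using len by (simp add: map_of_zip_is_None)
    then show ?thesis using False by (simp add: \<sigma>'_def override_on_def)
  qed
  then have "((\<lambda>t. trm_val g (override_on \<omega> (X t) (set xs))) has_real_derivative
      trm_val (derivation g) (case_sym (override_on \<omega> (X s) (set xs)) \<sigma>')) (at s within S)"
    by (intro trm_val_has_derivative)
  moreover have "trm_val (derivation g) (case_sym (override_on \<omega> (X s) (set xs)) \<sigma>')
      = trm_val (subst_diff xs fs (derivation g)) c"
    unfolding trm_val_subst_diff
  proof (rule trm_val_cong)
    fix w assume w: "w \<in> set_trm (derivation g)"
    show "(case w of Base v \<Rightarrow> override_on \<omega> (X s) (set xs) v | Prime v \<Rightarrow> \<sigma>' v)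
        = trm_val (subst_sym xs fs w) c"
    proof (cases w)
      case (Base v)
      \<comment> \<open>On control variables the two states differ: one keeps the values of
        \<open>\<omega>\<close>, the other carries those of \<open>y\<close> and \<open>z\<close>.
        Hence \<open>g\<close> has to avoid them.\<close>
      then have "v \<notin> set ys" "v \<notin> set zs" using w set_trm_derivation[of g] g by auto
      then show ?thesis using Base by (simp add: c_def combined_def override_on_def)
    qed (simp add: \<sigma>'_def)
  qed
  ultimately show ?thesis by (simp add: c_def)
qed

text \<open>The control that is frozen on \<open>[i * h, (i + 1) * h)\<close>, for \<open>i < k\<close>, to the value that the
  policy \<open>p\<close> selects for the state observed at time \<open>i * h\<close>; the last cell extends to \<open>T\<close>.\<close>

primrec sampled :: "(('v \<Rightarrow> real) \<Rightarrow> 'v \<Rightarrow> real) \<Rightarrow> real \<Rightarrow> real \<Rightarrow> 'v state \<Rightarrow> (real \<Rightarrow> 'v \<Rightarrow> real)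
    \<Rightarrow> nat \<Rightarrow> real \<Rightarrow> 'v \<Rightarrow> real" where
  "sampled p h T \<omega> y 0 = (\<lambda>s\<in>{0..T}. p \<omega>)"
| "sampled p h T \<omega> y (Suc k) = (\<lambda>s\<in>{0..T}. if s < real k * h then sampled p h T \<omega> y k s
     else p (restrict (traj T \<omega> y (sampled p h T \<omega> y k) (real k * h)) (set xs)))"

lemma controls_const:
  assumes "q \<in> defined_set vs \<phi>"
  shows "(\<lambda>s\<in>{0..T}. q) \<in> controls T vs \<phi>"
proof -
  have "q \<in> space (PiM (set vs) (\<lambda>_. borel))"
    using assms by (simp add: defined_set_def space_PiM)
  then have "(\<lambda>s. q) \<in> lebesgue_on {0..T} \<rightarrow>\<^sub>M PiM (set vs) (\<lambda>_. borel)" by simp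
  then have "(\<lambda>s\<in>{0..T}. q) \<in> lebesgue_on {0..T} \<rightarrow>\<^sub>M PiM (set vs) (\<lambda>_. borel)"
    by (rule measurable_cong[THEN iffD1, rotated]) (simp add: restrict_def)
  then show ?thesis using assms by (simp add: controls_def)
qed

lemma controls_switch:
  assumes u: "u \<in> controls T vs \<phi>" and w: "w \<in> controls T vs \<phi>"
  shows "(\<lambda>s\<in>{0..T}. if s < c then u s else w s) \<in> controls T vs \<phi>"
proof -
  have "{s \<in> space (lebesgue_on {0..T}). s < c} \<in> sets (lebesgue_on {0..T})"
    using borel_measurable_less[OF id_borel_measurable_lebesgue_on[of "{0..T}"] borel_measurable_const[of c]]
    by simp
  then have "(\<lambda>s. if s < c then u s else w s) \<in> lebesgue_on {0..T} \<rightarrow>\<^sub>M PiM (set vs) (\<lambda>_. borel)"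
    using u w by (intro measurable_If) (simp_all add: controls_def)
  then have "(\<lambda>s\<in>{0..T}. if s < c then u s else w s) \<in> lebesgue_on {0..T} \<rightarrow>\<^sub>M PiM (set vs) (\<lambda>_. borel)"
    by (rule measurable_cong[THEN iffD1, rotated]) (simp add: restrict_def)
  then show ?thesis using controls_in[OF u] controls_in[OF w] by (simp add: controls_def)
qed

context
  fixes p :: "('v \<Rightarrow> real) \<Rightarrow> 'v \<Rightarrow> real" and h T :: real and \<omega> :: "'v state"
  assumes p: "\<And>x. p x \<in> defined_set zs Z" and h: "0 \<le> h"
begin

abbreviation "ctl \<equiv> sampled p h T \<omega>"

text \<open>\<open>p\<close> is an arbitrary choice function; measurability holds because each stage
  only inserts a single value of \<open>p\<close>, switched on at a fixed time.\<close>

lemma sampled_controls: "ctl y k \<in> controls T zs Z"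
proof (induction k)
  case 0
  show ?case unfolding sampled.simps(1) by (rule controls_const[OF p])
next
  case (Suc k)
  define q where "q = p (restrict (traj T \<omega> y (ctl y k) (real k * h)) (set xs))"
  have "ctl y (Suc k) = (\<lambda>s\<in>{0..T}. if s < real k * h then ctl y k s else (\<lambda>s\<in>{0..T}. q) s)"
    unfolding sampled.simps(2) q_def by (rule restrict_ext) simp
  moreover have "(\<lambda>s\<in>{0..T}. q) \<in> controls T zs Z"
    unfolding q_def by (rule controls_const[OF p])
  ultimately show ?case using controls_switch[OF Suc, of "\<lambda>s\<in>{0..T}. q"] by (simp only:)
qed

lemma sampled_nonanticipative:
  assumes y: "y \<in> controls T ys Y" and y': "y' \<in> controls T ys Y" and s: "s \<in> {0..T}"
    and eq: "AE t in lebesgue_on {0..s}. y t = y' t"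
  shows "AE t in lebesgue_on {0..s}. ctl y k t = ctl y' k t"
proof (induction k)
  case 0
  show ?case by simp
next
  case (Suc k)
  show ?case
  \<comment> \<open>If the sampling time is within \<open>{0..s}\<close>, causality makes both plays
    observe the same state, so the same value is held. Otherwise the new stage changes nothing on
    \<open>{0..s}\<close>.\<close>
  proof (cases "real k * h \<le> s")
    case True
    have kh: "0 \<le> real k * h" "real k * h \<le> T" using True s h by auto
    have sub: "AE t in lebesgue_on {0..real k * h}. y t = y' t"
      "AE t in lebesgue_on {0..real k * h}. ctl y k t = ctl y' k t"
      using True by (auto intro: AE_lebesgue_on_subset[OF eq] AE_lebesgue_on_subset[OF Suc])
    have "restrict (traj T \<omega> y (ctl y k) (real k * h)) (set xs)
        = restrict (traj T \<omega> y' (ctl y' k) (real k * h)) (set xs)"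
    proof (rule restrict_ext)
      fix v assume "v \<in> set xs"
      then show "traj T \<omega> y (ctl y k) (real k * h) v = traj T \<omega> y' (ctl y' k) (real k * h) v"
        using traj_local[OF kh y y' sampled_controls sampled_controls sub] kh by simp
    qed
    then show ?thesis using Suc by (auto elim!: eventually_mono)
  next
    case False
    show ?thesis by (rule lebesgue_on_mono[OF Suc]) (use False in auto)
  qed
qed

lemma sampled_strategy:
  "(\<lambda>y. ctl y k) \<in> strategies T (controls T ys Y) (controls T zs Z)"
  unfolding strategies_def using sampled_controls sampled_nonanticipative by blast

lemma sampled_agree:
  assumes "k \<le> m" "s < real k * h" "s \<in> {0..T}"
  shows "ctl y m s = ctl y k s"
  using assms(1)
proof (induction m rule: dec_induct)
  case (step m)
  have "real k * h \<le> real m * h" using step(1) h by (intro mult_right_mono) auto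
  then have lt: "s < real m * h" using assms(2) by linarith
  show ?case using step.IH assms(3) by (simp add: lt del: atLeastAtMost_iff)
qed simp

lemma traj_sampled_agree:
  assumes "k \<le> m" "real k * h \<le> T" "y \<in> controls T ys Y" "v \<in> set xs"
  shows "traj T \<omega> y (ctl y m) (real k * h) v = traj T \<omega> y (ctl y k) (real k * h) v"
proof (rule traj_local[OF _ assms(2,3,3) sampled_controls sampled_controls _ _ assms(4)])
  \<comment> \<open>Stages agree strictly before \<open>k * h\<close>; at that time itself they may
    differ, but a single point is a null set.\<close>
  have "t = real k * h" if "t \<in> {0..real k * h}" "ctl y m t \<noteq> ctl y k t" for t
  proof (rule ccontr)
    assume "t \<noteq> real k * h"
    then have "t < real k * h" "t \<in> {0..T}" using that(1) assms(2) by auto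
    then show False using sampled_agree[OF assms(1)] that(2) by blast
  qed
  then have "{t \<in> {0..real k * h}. ctl y m t \<noteq> ctl y k t} \<subseteq> {real k * h}" by blast
  then have "negligible {t \<in> {0..real k * h}. ctl y m t \<noteq> ctl y k t}"
    by (rule negligible_subset[rotated]) simp
  then show "AE t in lebesgue_on {0..real k * h}. ctl y m t = ctl y k t"
    by (simp add: AE_lebesgue_on_iff_negligible)
qed (use h in simp_all)

text \<open>Closes the loop: stage \<open>k\<close> was built from its own trajectory, but by
  causality the state it sampled is the one reached under the final control.\<close>

lemma sampled_on_cell:
  assumes k: "k < m" and s: "real k * h \<le> s" "s < real (Suc k) * h" "s \<in> {0..T}"
    and y: "y \<in> controls T ys Y"
  shows "ctl y m s = p (restrict (traj T \<omega> y (ctl y m) (real k * h)) (set xs))"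
proof -
  have "real k * h \<le> T" using s by simp
  then have "restrict (traj T \<omega> y (ctl y m) (real k * h)) (set xs)
      = restrict (traj T \<omega> y (ctl y k) (real k * h)) (set xs)"
    by (intro restrict_ext traj_sampled_agree[OF less_imp_le[OF k] _ y])
  moreover have "ctl y m s = ctl y (Suc k) s"
    using k s by (intro sampled_agree) simp_all
  moreover have "ctl y (Suc k) s = p (restrict (traj T \<omega> y (ctl y k) (real k * h)) (set xs))"
    using s by (simp del: of_nat_Suc)
  ultimately show ?thesis by (simp only:)
qed

end

section \<open>Growth along trajectories and arrival at the target\<close>

lemma traj_box:
  assumes "0 \<le> T" "y \<in> controls T ys Y" "z \<in> controls T zs Z" "v \<in> set xs" "t \<in> {0..T}"
  shows "\<bar>traj T \<omega> y z t v - \<omega> v\<bar> \<le> M * T"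
proof -
  have "\<bar>traj T \<omega> y z t v - traj T \<omega> y z 0 v\<bar> \<le> M * \<bar>t - 0\<bar>"
    by (rule traj_lipschitz[OF assms(1-3)]) (use assms in simp_all)
  also have "\<dots> \<le> M * T" using M assms(5) by (intro mult_left_mono) simp_all
  finally show ?thesis by (simp only: traj_0[OF assms(1-4)])
qed

text \<open>\<open>G\<close> is Lipschitz, hence absolutely continuous, and so is the integral of
  its almost everywhere derivative, which is at least \<open>c\<close>. The bound is asked on a
  half-open interval because the control switches at \<open>b\<close>.\<close>

lemma trm_increase_along_traj:
  fixes \<omega> T y z g
  defines "X \<equiv> traj T \<omega> y z" and "G \<equiv> \<lambda>t. trm_val g (override_on \<omega> (traj T \<omega> y z t) (set xs))"
  assumes y: "y \<in> controls T ys Y" and z: "z \<in> controls T zs Z"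
    and ab: "0 \<le> a" "a \<le> b" "b \<le> T" and g: "set_trm g \<inter> (set ys \<union> set zs) = {}"
    and c: "\<And>s. s \<in> {a..<b} \<Longrightarrow>
      c \<le> trm_val (subst_diff xs fs (derivation g)) (combined \<omega> (X s) (y s) (z s))"
  shows "c * (b - a) \<le> G b - G a"
proof -
  have T: "0 \<le> T" using ab by linarith
  define R where "R = (\<Sum>v\<in>set_trm g. \<bar>\<omega> v\<bar>) + M * T"
  obtain L where L: "\<forall>\<nu> \<nu>' d. d \<ge> 0 \<longrightarrow>
      (\<forall>v\<in>set_trm g. \<bar>\<nu> v\<bar> \<le> R \<and> \<bar>\<nu>' v\<bar> \<le> R \<and> \<bar>\<nu> v - \<nu>' v\<bar> \<le> d) \<longrightarrow>
      \<bar>trm_val g \<nu> - trm_val g \<nu>'\<bar> \<le> L * d"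
    using trm_val_lipschitz_on_box by (rule exE)
  have R: "\<bar>override_on \<omega> (X t) (set xs) v\<bar> \<le> R" if "v \<in> set_trm g" "t \<in> {0..T}" for v t
  proof -
    have "\<bar>\<omega> v\<bar> \<le> (\<Sum>v\<in>set_trm g. \<bar>\<omega> v\<bar>)"
      using that(1) by (intro member_le_sum) (simp_all add: finite_set_trm)
    moreover have "v \<in> set xs \<Longrightarrow> \<bar>X t v - \<omega> v\<bar> \<le> M * T"
      unfolding X_def by (rule traj_box[OF T y z _ that(2)])
    moreover have "0 \<le> M * T" using M T by simp
    ultimately show ?thesis unfolding R_def override_on_def by (cases "v \<in> set xs") simp_all
  qed
  have "\<bar>G s - G t\<bar> \<le> \<bar>L\<bar> * M * \<bar>s - t\<bar>" if st: "s \<in> {0..T}" "t \<in> {0..T}" for s t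
  proof -
    have d0: "0 \<le> M * \<bar>s - t\<bar>" using M by simp
    have "\<bar>override_on \<omega> (X s) (set xs) v - override_on \<omega> (X t) (set xs) v\<bar> \<le> M * \<bar>s - t\<bar>" for v
      using traj_lipschitz[OF T y z _ st, of v \<omega>] d0 by (cases "v \<in> set xs") (simp_all add: X_def override_on_def)
    then have "\<bar>G s - G t\<bar> \<le> L * (M * \<bar>s - t\<bar>)"
      unfolding G_def X_def[symmetric] using R st by (intro L[rule_format, OF d0] conjI)
    also have "\<dots> \<le> \<bar>L\<bar> * (M * \<bar>s - t\<bar>)" by (rule mult_right_mono[OF abs_ge_self d0])
    finally show ?thesis by (simp add: mult.assoc)
  qed
  then have "abs_continuous_on {0..T} G"
    by (rule lipschitz_imp_abs_continuous_on[rotated]) (use M in simp_all)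
  then have AC: "abs_continuous_on {a..b} G"
    by (rule abs_continuous_on_subset) (use ab in auto)
  \<comment> \<open>The end point \<open>b\<close> joins the exceptional set, since nothing is
    assumed about the derivative there.\<close>
  define N where "N = {s \<in> {0..T}. \<not> (\<forall>i<length xs.
      ((\<lambda>t. X t (xs ! i)) has_real_derivative trm_val (fs ! i) (combined \<omega> (X s) (y s) (z s)))
        (at s within {0..T}))} \<union> {b}"
  have "AE s in lebesgue_on {0..T}. \<forall>i<length xs.
      ((\<lambda>t. X t (xs ! i)) has_real_derivative trm_val (fs ! i) (combined \<omega> (X s) (y s) (z s)))
        (at s within {0..T})"
    using traj_caratheodory[OF T y z, of \<omega>] unfolding caratheodory_solution_def combined_def X_def by blast
  then have N: "negligible N" by (simp add: N_def AE_lebesgue_on_iff_negligible)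
  \<comment> \<open>The value \<open>c\<close> on \<open>N\<close> makes the comparison with
    \<open>c\<close> hold at every point, as \<open>has_integral_le\<close> requires.\<close>
  define w where "w = (\<lambda>s. if s \<in> N then c
    else trm_val (subst_diff xs fs (derivation g)) (combined \<omega> (X s) (y s) (z s)))"
  have w: "(w has_integral G b - G a) {a..b}"
  proof (rule abs_continuous_has_integral[OF ab(2) AC N])
    fix s assume s: "s \<in> {a..b} - N"
    then have sT: "s \<in> {0..T}" using ab by auto
    have "(G has_real_derivative trm_val (subst_diff xs fs (derivation g)) (combined \<omega> (X s) (y s) (z s)))
        (at s within {0..T})"
      unfolding G_def X_def[symmetric]
      by (rule trm_derivative_along_solution[OF _ g]) (use s sT in \<open>simp add: N_def\<close>)
    then have "(G has_real_derivative w s) (at s within {0..T})" using s by (simp add: w_def)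
    then show "(G has_real_derivative w s) (at s within {a..b})"
      by (rule DERIV_subset) (use ab in auto)
  qed
  have const: "((\<lambda>s. c) has_integral c * (b - a)) {a..b}"
    using has_integral_const_real[of c a b] ab by (simp add: mult.commute)
  have "c \<le> w s" if "s \<in> {a..b}" for s
  proof (cases "s \<in> N")
    case False
    then have "s \<noteq> b" by (simp add: N_def)
    then have "s \<in> {a..<b}" using that by simp
    then show ?thesis using c False by (simp add: w_def)
  qed (simp add: w_def)
  from has_integral_le[OF const w this] show ?thesis .
qed

theorem policy_reaches_target:
  assumes p: "\<And>x. p x \<in> defined_set zs Z" and \<epsilon>: "0 < \<epsilon>"
    and g: "set_trm g \<inter> (set ys \<union> set zs) = {}"
    and incr: "\<And>x q. q \<in> defined_set ys Y \<Longrightarrow> trm_val g (override_on \<omega> x (set xs)) \<le> 0 \<Longrightarrow>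
      \<epsilon> \<le> trm_val (subst_diff xs fs (derivation g)) (combined \<omega> x q (p x))"
  shows "fml_true (Diamond xs fs ys Y zs Z (FO (Geq g (Const 0)))) \<omega>"
proof -
  define H where "H = subst_diff xs fs (derivation g)"
  \<comment> \<open>At rate \<open>\<epsilon> / 2\<close> the first summand is the time needed to
    gain \<open>\<bar>trm_val g \<omega>\<bar>\<close>; the second adds a surplus of
    \<open>\<epsilon> / 2\<close> and keeps \<open>T\<close> positive.\<close>
  define T where "T = 2 * \<bar>trm_val g \<omega>\<bar> / \<epsilon> + 1"
  have T: "0 < T" using \<epsilon> by (simp add: T_def add_nonneg_pos)
  define R where "R = (\<Sum>v\<in>set_trm H. \<bar>\<omega> v\<bar>) + M * T + \<bar>B\<bar>"
  obtain L where L: "\<forall>\<nu> \<nu>' d. d \<ge> 0 \<longrightarrow>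
      (\<forall>v\<in>set_trm H. \<bar>\<nu> v\<bar> \<le> R \<and> \<bar>\<nu>' v\<bar> \<le> R \<and> \<bar>\<nu> v - \<nu>' v\<bar> \<le> d) \<longrightarrow>
      \<bar>trm_val H \<nu> - trm_val H \<nu>'\<bar> \<le> L * d"
    using trm_val_lipschitz_on_box by (rule exE)
  \<comment> \<open>So many cells that the state moves by at most \<open>M * h\<close> within one
    and the Lie derivative changes by at most \<open>\<epsilon> / 2\<close>.\<close>
  obtain n :: nat where n: "2 * \<bar>L\<bar> * M * T / \<epsilon> < real n" using reals_Archimedean2 by blast
  define m where "m = Suc n"
  define h where "h = T / real m"
  have m: "real m > 0" by (simp add: m_def)
  have h: "0 < h" using T m by (simp add: h_def)
  have mh: "real m * h = T" using m by (simp add: h_def)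
  have small: "\<bar>L\<bar> * (M * h) \<le> \<epsilon> / 2"
  proof -
    have "2 * \<bar>L\<bar> * M * T < real n * \<epsilon>" using n \<epsilon> by (simp add: pos_divide_less_eq)
    also have "\<dots> \<le> real m * \<epsilon>" using \<epsilon> by (simp add: m_def)
    finally show ?thesis using m by (simp add: h_def field_simps)
  qed
  define \<beta> where "\<beta> = (\<lambda>y. sampled p h T \<omega> y m)"
  have \<beta>: "\<beta> \<in> strategies T (controls T ys Y) (controls T zs Z)"
    unfolding \<beta>_def by (rule sampled_strategy[OF p less_imp_le[OF h]])
  have "\<exists>\<zeta>\<in>{0..T}. 0 \<le> trm_val g (response T xs fs ys y zs (\<beta> y) \<omega> \<zeta>)"
    if y: "y \<in> controls T ys Y" for y
  proof (rule ccontr)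
    define z where "z = \<beta> y"
    define X where "X = traj T \<omega> y z"
    define G where "G = (\<lambda>t. trm_val g (override_on \<omega> (X t) (set xs)))"
    assume "\<not> (\<exists>\<zeta>\<in>{0..T}. 0 \<le> trm_val g (response T xs fs ys y zs (\<beta> y) \<omega> \<zeta>))"
    then have neg: "G t < 0" if "t \<in> {0..T}" for t
      using that unfolding G_def X_def z_def response_def by (simp add: not_le)
    have z: "z \<in> controls T zs Z"
      unfolding z_def \<beta>_def by (rule sampled_controls[OF p less_imp_le[OF h]])
    have "override_on \<omega> (X 0) (set xs) = \<omega>"
      using traj_0[OF less_imp_le[OF T] y z, of _ \<omega>] by (auto simp: X_def override_on_def fun_eq_iff)
    then have G0: "G 0 = trm_val g \<omega>" by (simp add: G_def)
    have cell: "\<epsilon> / 2 * (real (Suc k) * h - real k * h) \<le> G (real (Suc k) * h) - G (real k * h)"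
      if k: "k < m" for k
      unfolding G_def X_def
    proof (rule trm_increase_along_traj[OF y z _ _ _ g])
      show "0 \<le> real k * h" "real k * h \<le> real (Suc k) * h" using h by (simp_all add: algebra_simps)
      have "real (Suc k) * h \<le> real m * h" using k h by (intro mult_right_mono) simp_all
      then show kT: "real (Suc k) * h \<le> T" by (simp only: mh)
      fix s assume s: "s \<in> {real k * h..<real (Suc k) * h}"
      define a where "a = real k * h"
      have sa: "0 \<le> s - a" "s - a \<le> h" using s by (simp_all add: a_def algebra_simps)
      have a0: "0 \<le> a" using h by (simp add: a_def)
      have "s \<le> T" using s kT by simp
      then have sT: "s \<in> {0..T}" "a \<in> {0..T}" using a0 sa by simp_all
      have zs: "z s = p (restrict (X a) (set xs))"
        unfolding z_def \<beta>_def X_def a_def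
        by (rule sampled_on_cell[OF p less_imp_le[OF h] k _ _ sT(1) y]) (use s in simp_all)
      have ys: "y s \<in> defined_set ys Y" and zs': "z s \<in> defined_set zs Z"
        using controls_in[OF y sT(1)] controls_in[OF z sT(1)] .
      have "override_on \<omega> (restrict (X a) (set xs)) (set xs) = override_on \<omega> (X a) (set xs)"
        by (simp add: override_on_def fun_eq_iff)
      then have "trm_val g (override_on \<omega> (restrict (X a) (set xs)) (set xs)) \<le> 0"
        using neg[OF sT(2)] by (simp add: G_def)
      \<comment> \<open>The state is the sampled one but the opponent's value is the current
        \<open>y s\<close>: \<open>incr\<close> holds for every admissible \<open>q\<close>. Hence
        only the state moves between \<open>a\<close> and \<open>s\<close>, and no regularity in
        time of \<open>y\<close> enters.\<close>
      from incr[OF ys this]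
      have "\<epsilon> \<le> trm_val H (combined \<omega> (X a) (y s) (z s))"
        unfolding H_def zs by (subst combined_cong[of "X a" "restrict (X a) (set xs)"]) simp_all
      moreover have "\<bar>trm_val H (combined \<omega> (X s) (y s) (z s)) - trm_val H (combined \<omega> (X a) (y s) (z s))\<bar>
          \<le> L * (M * h)"
      proof -
        have Mh: "0 \<le> M * h" using M h by simp
        have box: "\<bar>combined \<omega> (X t) (y s) (z s) v\<bar> \<le> R" if "v \<in> set_trm H" "t \<in> {0..T}" for v t
        proof -
          have \<omega>: "\<bar>\<omega> v\<bar> \<le> (\<Sum>v\<in>set_trm H. \<bar>\<omega> v\<bar>)"
            using that(1) by (intro member_le_sum) (simp_all add: finite_set_trm)
          have MT: "0 \<le> M * T" using M T by simp
          consider "v \<in> set xs" | "v \<in> set ys" | "v \<in> set zs" | "v \<notin> set xs" "v \<notin> set ys" "v \<notin> set zs"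
            by blast
          then show ?thesis
          proof cases
            case 1
            then have "\<bar>X t v - \<omega> v\<bar> \<le> M * T"
              unfolding X_def by (rule traj_box[OF less_imp_le[OF T] y z _ that(2)])
            then show ?thesis using \<omega> 1 by (simp add: combined_simps R_def)
          next
            case 2
            then show ?thesis using Y_bound[OF ys 2] \<omega> MT by (simp add: combined_simps R_def)
          next
            case 3
            then show ?thesis using Z_bound[OF zs' 3] \<omega> MT by (simp add: combined_simps R_def)
          next
            case 4
            then show ?thesis using \<omega> MT by (simp add: combined_simps R_def)
          qed
        qed
        have "\<bar>combined \<omega> (X s) (y s) (z s) v - combined \<omega> (X a) (y s) (z s) v\<bar> \<le> M * h" for v
        proof (cases "v \<in> set xs")
          case True
          have "\<bar>X s v - X a v\<bar> \<le> M * \<bar>s - a\<bar>"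
            unfolding X_def by (rule traj_lipschitz[OF less_imp_le[OF T] y z True sT])
          also have "\<dots> \<le> M * h" using M sa by (intro mult_left_mono) simp_all
          finally show ?thesis using True by (simp add: combined_simps)
        next
          case False
          then show ?thesis using Mh by (simp add: combined_def override_on_def)
        qed
        then show ?thesis using L[rule_format, OF Mh] box sT by simp
      qed
      moreover have "L * (M * h) \<le> \<bar>L\<bar> * (M * h)"
        using M h by (intro mult_right_mono) simp_all
      ultimately show "\<epsilon> / 2 \<le> trm_val (subst_diff xs fs (derivation g))
          (combined \<omega> (traj T \<omega> y z s) (y s) (z s))"
        using small unfolding H_def X_def by linarith
    qed
    have "\<epsilon> / 2 * (real k * h) \<le> G (real k * h) - G 0" if "k \<le> m" for k
      using that
    proof (induction k)
      case (Suc k)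
      then show ?case using cell[of k] unfolding right_diff_distrib by simp
    qed simp
    \<comment> \<open>\<open>G\<close> would gain \<open>\<bar>G 0\<bar> + \<epsilon> / 2\<close>
      over \<open>{0..T}\<close> and so be positive at \<open>T\<close>.\<close>
    from this[of m] have "\<epsilon> / 2 * T \<le> G T - G 0" by (simp only: mh order_refl)
    moreover have "\<epsilon> / 2 * T = \<bar>trm_val g \<omega>\<bar> + \<epsilon> / 2"
      using \<epsilon> by (simp add: T_def field_simps)
    moreover have "G T < 0" using neg[of T] T by simp
    ultimately show False using \<epsilon> unfolding G0 by linarith
  qed
  then show ?thesis using T \<beta> by (auto intro!: exI[of _ T] bexI[of _ \<beta>])
qed

end

text \<open>\<open>policy_reaches_target\<close> does the analysis; what remains is to read the
  syntactic premise semantically. As \<open>e\<close> is fresh, storing \<open>\<epsilon>\<close> in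
  it affects neither \<open>g\<close> nor its Lie derivative.\<close>

theorem theorem5p22:
  fixes xs ys zs :: "'v list" and e :: 'v
    and fs :: "'v trm list" and g :: "'v trm" and Y Z :: "'v fol"
  assumes "distinct (xs @ ys @ zs)"
    and "length fs = length xs"
    and "\<forall>\<theta>\<in>set fs. set_trm \<theta> \<subseteq> set xs \<union> set ys \<union> set zs"
    and "fol_fv Y \<subseteq> set ys" and "fol_fv Z \<subseteq> set zs"
    and "compactin (powertop_real (set ys)) (defined_set ys Y)"
    and "compactin (powertop_real (set zs)) (defined_set zs Z)"
    and "\<forall>\<theta>\<in>set fs. bounded (trm_val \<theta> `
           {\<nu>. restrict \<nu> (set ys) \<in> defined_set ys Y \<and> restrict \<nu> (set zs) \<in> defined_set zs Z})"
    and "set_trm g \<inter> (set ys \<union> set zs) = {}"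
    and "e \<notin> set xs \<union> set ys \<union> set zs \<union> set_trm g"
    and "valid (FO (Exi e (Conj (Greater (Var e) (Const 0))
           (Forall_vec xs (Exists_vec zs (Conj Z
             (Forall_vec ys (Imp Y (Imp (Leq g (Const 0))
               (Geq (subst_diff xs fs (derivation g)) (Var e)))))))))))"
  shows "valid (Diamond xs fs ys Y zs Z (FO (Geq g (Const 0))))"
  unfolding valid_def
proof
  fix \<omega> :: "'v state"
  obtain BY where BY: "\<And>p v. p \<in> defined_set ys Y \<Longrightarrow> v \<in> set ys \<Longrightarrow> \<bar>p v\<bar> \<le> BY"
    using compactin_defined_set_bounded[OF assms(6)] by blast
  obtain BZ where BZ: "\<And>p v. p \<in> defined_set zs Z \<Longrightarrow> v \<in> set zs \<Longrightarrow> \<bar>p v\<bar> \<le> BZ"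
    using compactin_defined_set_bounded[OF assms(7)] by blast
  have "\<forall>\<theta>\<in>set fs. \<exists>M. \<forall>\<nu>. restrict \<nu> (set ys) \<in> defined_set ys Y \<and>
      restrict \<nu> (set zs) \<in> defined_set zs Z \<longrightarrow> \<bar>trm_val \<theta> \<nu>\<bar> \<le> M"
  proof
    fix \<theta> assume "\<theta> \<in> set fs"
    with assms(8) obtain M where "\<forall>r\<in>trm_val \<theta> ` {\<nu>. restrict \<nu> (set ys) \<in> defined_set ys Y \<and>
        restrict \<nu> (set zs) \<in> defined_set zs Z}. norm r \<le> M"
      unfolding bounded_iff by blast
    then show "\<exists>M. \<forall>\<nu>. restrict \<nu> (set ys) \<in> defined_set ys Y \<and>
        restrict \<nu> (set zs) \<in> defined_set zs Z \<longrightarrow> \<bar>trm_val \<theta> \<nu>\<bar> \<le> M"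
      by (intro exI[of _ M]) simp
  qed
  then obtain M where M: "\<forall>\<theta>\<in>set fs. \<forall>\<nu>. restrict \<nu> (set ys) \<in> defined_set ys Y \<and>
      restrict \<nu> (set zs) \<in> defined_set zs Z \<longrightarrow> \<bar>trm_val \<theta> \<nu>\<bar> \<le> M \<theta>"
    by (rule bchoice[THEN exE])
  interpret control_system xs ys zs fs Y Z "\<Sum>\<theta>\<in>set fs. \<bar>M \<theta>\<bar>" "max BY BZ"
  proof
    show "0 \<le> (\<Sum>\<theta>\<in>set fs. \<bar>M \<theta>\<bar>)" by (simp add: sum_nonneg)
    show "\<bar>p v\<bar> \<le> max BY BZ" if "p \<in> defined_set ys Y" "v \<in> set ys" for p v
      using BY[OF that] by simp
    show "\<bar>p v\<bar> \<le> max BY BZ" if "p \<in> defined_set zs Z" "v \<in> set zs" for p v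
      using BZ[OF that] by simp
    fix \<theta> and \<nu> :: "'v state" assume \<theta>: "\<theta> \<in> set fs" "restrict \<nu> (set ys) \<in> defined_set ys Y"
      "restrict \<nu> (set zs) \<in> defined_set zs Z"
    then have "\<bar>trm_val \<theta> \<nu>\<bar> \<le> M \<theta>" using M by blast
    also have "\<dots> \<le> \<bar>M \<theta>\<bar>" by simp
    also have "\<dots> \<le> (\<Sum>\<theta>\<in>set fs. \<bar>M \<theta>\<bar>)" using \<theta>(1) by (intro member_le_sum) simp_all
    finally show "\<bar>trm_val \<theta> \<nu>\<bar> \<le> (\<Sum>\<theta>\<in>set fs. \<bar>M \<theta>\<bar>)" .
  qed (use assms(1-3) in simp_all)
  define H where "H = subst_diff xs fs (derivation g)"
  \<comment> \<open>This nesting follows the quantifiers, with \<open>zs\<close> before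
    \<open>ys\<close>; \<open>combined\<close> has the opposite order. Disjointness makes the two
    agree away from \<open>e\<close>.\<close>
  define st where "st \<epsilon> x p q = override_on (override_on (override_on (fun_upd \<omega> e \<epsilon>) x (set xs)) p (set zs)) q (set ys)"
    for \<epsilon> x p q
  \<comment> \<open>The premise is evaluated at the initial state, so \<open>\<epsilon>\<close> may
    depend on parameters outside the three vectors; these stay constant along trajectories.\<close>
  obtain \<epsilon> where "\<not> fun_upd \<omega> e \<epsilon> e \<le> 0" and policy: "\<forall>x. \<exists>p.
      fol_true Z (override_on (override_on (fun_upd \<omega> e \<epsilon>) x (set xs)) p (set zs)) \<and>
      (\<forall>q. \<not> (fol_true Y (st \<epsilon> x p q) \<and> \<not> \<not> (trm_val g (st \<epsilon> x p q) \<le> 0 \<and>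
        \<not> st \<epsilon> x p q e \<le> trm_val H (st \<epsilon> x p q))))"
    using assms(11)[unfolded valid_def fml_true.simps, THEN spec[of _ \<omega>]]
    unfolding fol_true.simps trm_val.simps fol_true_Forall_vec fol_true_Exists_vec H_def st_def
    by (elim exE conjE)
  then have \<epsilon>: "0 < \<epsilon>" by simp
  obtain p0 where p0: "\<forall>x. fol_true Z (override_on (override_on (fun_upd \<omega> e \<epsilon>) x (set xs)) (p0 x) (set zs)) \<and>
      (\<forall>q. \<not> (fol_true Y (st \<epsilon> x (p0 x) q) \<and> \<not> \<not> (trm_val g (st \<epsilon> x (p0 x) q) \<le> 0 \<and>
        \<not> st \<epsilon> x (p0 x) q e \<le> trm_val H (st \<epsilon> x (p0 x) q))))"
    using choice[OF policy] by (rule exE)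
  \<comment> \<open>The chosen values are arbitrary outside \<open>zs\<close>; restriction turns
    them into points of \<open>defined_set zs Z\<close>.\<close>
  define p where "p x = restrict (p0 x) (set zs)" for x
  have H_vars: "set_trm H \<subseteq> set_trm g \<union> set xs \<union> set ys \<union> set zs"
    unfolding H_def using set_trm_subst_derivation[of xs fs g] vars by blast
  show "fml_true (Diamond xs fs ys Y zs Z (FO (Geq g (Const 0)))) \<omega>"
  proof (rule policy_reaches_target[of p, OF _ \<epsilon> assms(9)])
    show "p x \<in> defined_set zs Z" for x
    proof -
      have "fol_true Z (p x) = fol_true Z (override_on (override_on (fun_upd \<omega> e \<epsilon>) x (set xs)) (p0 x) (set zs))"
        by (rule fol_true_cong) (use assms(5) in \<open>auto simp: p_def override_on_def\<close>)
      then show ?thesis using conjunct1[OF p0[rule_format, of x]] by (simp add: defined_set_def p_def)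
    qed
    fix x q assume q: "q \<in> defined_set ys Y" and neg: "trm_val g (override_on \<omega> x (set xs)) \<le> 0"
    define \<nu> where "\<nu> = st \<epsilon> x (p0 x) q"
    have agree: "\<nu> v = combined \<omega> x q (p x) v" if "v \<noteq> e" for v
      using that by (auto simp: \<nu>_def st_def combined_def override_on_def p_def disjoint)
    have "fol_true Y \<nu> = fol_true Y q"
      by (rule fol_true_cong) (use assms(4) in \<open>auto simp: \<nu>_def st_def override_on_def\<close>)
    then have "fol_true Y \<nu>" using q by (simp add: defined_set_def)
    moreover have "trm_val g \<nu> = trm_val g (override_on \<omega> x (set xs))"
    proof (rule trm_val_cong)
      fix v assume "v \<in> set_trm g"
      then have "v \<noteq> e" "v \<notin> set ys" "v \<notin> set zs" using assms(9,10) by auto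
      then show "\<nu> v = override_on \<omega> x (set xs) v" by (simp add: \<nu>_def st_def override_on_def)
    qed
    moreover have "\<nu> e = \<epsilon>" using assms(10) by (simp add: \<nu>_def st_def override_on_def)
    moreover have "trm_val H \<nu> = trm_val H (combined \<omega> x q (p x))"
    proof (rule trm_val_cong)
      fix v assume "v \<in> set_trm H"
      then have "v \<noteq> e" using H_vars assms(10) by blast
      then show "\<nu> v = combined \<omega> x q (p x) v" by (rule agree)
    qed
    ultimately show "\<epsilon> \<le> trm_val (subst_diff xs fs (derivation g)) (combined \<omega> x q (p x))"
      using conjunct2[OF p0[rule_format, of x], THEN spec[of _ q], folded \<nu>_def] neg
      unfolding H_def by simp
  qed
qed

end
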